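(* Let $(\mathfrak A[\|\cdot\|_{\mathfrak A}],\mathfrak A_0)$ and $(\mathfrak B[\|\cdot\|_{\mathfrak B}],\mathfrak B_0)$ be (unital) Banach quasi *-algebras and let $\bar n$ be a uniform cross-norm on $\mathfrak A\otimes\mathfrak B$. Let $\pi_1:\mathfrak A[\|\cdot\|_{\mathfrak A}]\to\mathcal L^\dagger(\mathcal D_{\pi_1},\mathcal H_{\pi_1})[\tau_w]$ and $\pi_2:\mathfrak B[\|\cdot\|_{\mathfrak B}]\to\mathcal L^\dagger(\mathcal D_{\pi_2},\mathcal H_{\pi_2})[\tau_w]$ be continuous *-representations of $(\mathfrak A,\mathfrak A_0)$ and $(\mathfrak B,\mathfrak B_0)$, respectively. Then $\pi_1\otimes\pi_2:\mathfrak A\otimes_{\bar n}\mathfrak B\to\mathcal L^\dagger(\mathcal D_{\pi_1}\otimes\mathcal D_{\pi_2},\mathcal H_{\pi_1}\widehat\otimes_h\mathcal H_{\pi_2})[\tau_w]$ is a continuous *-representation of $(\mathfrak A\otimes_{\bar n}\mathfrak B,\mathfrak A_0\otimes\mathfrak B_0)$.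
   Context: All vector spaces are complex. A quasi *-algebra $(\mathfrak A,\mathfrak A_0)$ is a vector space $\mathfrak A$ with a *-algebra $\mathfrak A_0\subseteq\mathfrak A$ (as a subspace) such that: (i) products $ax$, $xa$ ($a\in\mathfrak A$, $x\in\mathfrak A_0$) are defined in $\mathfrak A$ and bilinear, extending the multiplication of $\mathfrak A_0$; (ii) $(xa)y=x(ay)$, $a(xy)=(ax)y$ for $x,y\in\mathfrak A_0$, $a\in\mathfrak A$; (iii) $\mathfrak A$ has an involution extending that of $\mathfrak A_0$ with $(ax)^*=x^*a^*$, $(xa)^*=a^*x^*$. It is unital if there is $e\in\mathfrak A_0$ with $ae=a=ea$ for all $a\in\mathfrak A$. It is a normed (Banach) quasi *-algebra if $\mathfrak A$ carries a (complete) norm with $\|a^*\|=\|a\|$, $\mathfrak A_0$ dense in $\mathfrak A$, and $a\mapsto ax$ continuous for every $x\in\mathfrak A_0$. Standing convention: quasi *-algebras are unital, with units of norm $1$. $\mathfrak A\otimes\mathfrak B$ is a quasi *-algebra over $\mathfrak A_0\otimes\mathfrak B_0$ via $(a\otimes b)(x\otimes y)=ax\otimes by$, $(x\otimes y)(a\otimes b)=xa\otimes yb$, $(a\otimes b)^*=a^*\otimes b^*$. A cross-norm $\bar n$ on $\mathfrak A\otimes\mathfrak B$ is a norm with $\|a\otimes b\|_{\bar n}=\|a\|_{\mathfrak A}\|b\|_{\mathfrak B}$; it is uniform if for all bounded linear $T_1:\mathfrak A\to\mathfrak A$, $T_2:\mathfrak B\to\mathfrak B$ the operator $T_1\otimes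 T_2$ is $\bar n$-bounded and its extension to the completion has norm $\le\|T_1\|\|T_2\|$. $\mathfrak A\otimes_{\bar n}\mathfrak B$ denotes $\mathfrak A\otimes\mathfrak B$ with the norm $\bar n$; it is understood that the involution is $\bar n$-isometric, so that it is a normed quasi *-algebra over $\mathfrak A_0\otimes\mathfrak B_0$. For a dense subspace $\mathcal D$ of a Hilbert space $\mathcal H$, $\mathcal L^\dagger(\mathcal D,\mathcal H)$ is the vector space of closable linear operators $T:\mathcal D\to\mathcal H$ whose adjoint has domain $\mathcal D(T^* )\supseteq\mathcal D$; $T^\dagger:=T^*|_{\mathcal D}$; the partial product $T\,\square\,S:=(T^\dagger)^*S$ is defined whenever $S\mathcal D\subseteq\mathcal D((T^\dagger)^* )$ and $T^\dagger\mathcal D\subseteq\mathcal D(S^* )$. The weak topology $\tau_w$ is given by the seminorms $T\mapsto|\langle T\xi|\eta\rangle|$, $\xi,\eta\in\mathcal D$. A *-representation of $(\mathfrak A,\mathfrak A_0)$ is a linear map $\pi:\mathfrak A\to\mathcal L^\dagger(\mathcal D_\pi,\mathcal H_\pi)$, $\mathcal D_\pi$ dense in the Hilbert space $\mathcal H_\pi$, such that $\pi(a^* )=\pi(a)^\dagger$ for all $a\in\mathfrak A$; for $a\in\mathfrak A$, $x\in\mathfrak A_0$ the product $\pi(a)\,\square\,\pi(x)$ is defined and equals $\pi(ax)$; and $\pi(e)$ is the identity on $\mathcal D_\pi$. $\mathcal H_{\pi_1}\widehat\otimes_h\mathcal H_{\pi_2}$ is the Hilbert space tensor product and $\mathcal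 D_{\pi_1}\otimes\mathcal D_{\pi_2}$ the algebraic tensor product inside it. The map $\pi_1\otimes\pi_2$ is defined by $(\pi_1\otimes\pi_2)(\sum_i a_i\otimes b_i)=\sum_i\pi_1(a_i)\otimes\pi_2(b_i)$, where $(\pi_1(a)\otimes\pi_2(b))(\xi\otimes\eta)=\pi_1(a)\xi\otimes\pi_2(b)\eta$ for $\xi\in\mathcal D_{\pi_1}$, $\eta\in\mathcal D_{\pi_2}$. *)

theory Defs
  imports "HOL-Analysis.Analysis" "HOL-Library.Poly_Mapping"
begin

section \<open>Complex vector spaces, Banach spaces and Hilbert spaces\<close>

class complex_vector = real_vector +
  fixes scaleC :: "complex \<Rightarrow> 'a \<Rightarrow> 'a"  (infixr \<open>*\<^sub>C\<close> 75)
  assumes scaleC_add_right: "c *\<^sub>C (x + y) = c *\<^sub>C x + c *\<^sub>C y"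
    and scaleC_add_left: "(c + d) *\<^sub>C x = c *\<^sub>C x + d *\<^sub>C x"
    and scaleC_scaleC: "c *\<^sub>C d *\<^sub>C x = (c * d) *\<^sub>C x"
    and scaleC_one: "1 *\<^sub>C x = x"
    and scaleR_scaleC: "r *\<^sub>R x = complex_of_real r *\<^sub>C x"

interpretation complex_vector: vector_space "scaleC :: complex \<Rightarrow> 'a \<Rightarrow> 'a::complex_vector"
  by unfold_locales (simp_all add: scaleC_add_right scaleC_add_left scaleC_scaleC scaleC_one)

abbreviation csubspace :: "'a::complex_vector set \<Rightarrow> bool"
  where "csubspace \<equiv> module.subspace scaleC"

abbreviation cspan :: "'a::complex_vector set \<Rightarrow> 'a set"
  where "cspan \<equiv> module.span scaleC"

abbreviation clinear :: "('a::complex_vector \<Rightarrow> 'b::complex_vector) \<Rightarrow> bool"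
  where "clinear \<equiv> Vector_Spaces.linear scaleC scaleC"

definition clinear_on :: "'a::complex_vector set \<Rightarrow> ('a \<Rightarrow> 'b::complex_vector) \<Rightarrow> bool"
  where "clinear_on V f \<longleftrightarrow>
    (\<forall>x\<in>V. \<forall>y\<in>V. f (x + y) = f x + f y) \<and> (\<forall>c. \<forall>x\<in>V. f (c *\<^sub>C x) = c *\<^sub>C f x)"

class complex_normed_vector = complex_vector + real_normed_vector +
  assumes norm_scaleC: "norm (c *\<^sub>C x) = cmod c * norm x"

class cbanach = complex_normed_vector + complete_space

class complex_inner = complex_normed_vector +
  fixes cinner :: "'a \<Rightarrow> 'a \<Rightarrow> complex"
  assumes cinner_add_left: "cinner (x + y) z = cinner x z + cinner y z"
    and cinner_scaleC_left: "cinner (c *\<^sub>C x) y = c * cinner x y"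
    and cinner_commute: "cinner y x = cnj (cinner x y)"
    and cinner_self: "cinner x x = complex_of_real ((norm x)\<^sup>2)"

class chilbert_space = complex_inner + complete_space

definition bounded_clinear ::
    "('a::complex_normed_vector \<Rightarrow> 'b::complex_normed_vector) \<Rightarrow> bool"
  where "bounded_clinear f \<longleftrightarrow> clinear f \<and> (\<exists>K. \<forall>x. norm (f x) \<le> norm x * K)"


section \<open>Quasi *-algebras\<close>

text \<open>
  One multiplication \<open>m :: 'a \<Rightarrow> 'a \<Rightarrow> 'a\<close> records \<open>ax\<close> and \<open>xa\<close> for \<open>a\<close> in the whole space and
  \<open>x \<in> A0\<close> as well as the product of \<open>A0\<close>, so that the first two extend the third by construction.
  Nothing is assumed about \<open>m a b\<close> when neither factor lies in \<open>A0\<close>.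
  Associativity of \<open>A0\<close> is the case \<open>a \<in> A0\<close> of \<open>right_assoc\<close>.
\<close>

locale quasi_star_algebra =
  fixes A0 :: "'a::complex_vector set"
    and m :: "'a \<Rightarrow> 'a \<Rightarrow> 'a"
    and star :: "'a \<Rightarrow> 'a"
    and e :: 'a
  assumes subspace: "csubspace A0"
    and mult_closed: "\<lbrakk>x \<in> A0; y \<in> A0\<rbrakk> \<Longrightarrow> m x y \<in> A0"
    and star_closed: "x \<in> A0 \<Longrightarrow> star x \<in> A0"
    and right_mult_linear: "x \<in> A0 \<Longrightarrow> clinear (\<lambda>a. m a x)"
    and left_mult_linear: "x \<in> A0 \<Longrightarrow> clinear (\<lambda>a. m x a)"
    and right_mult_linear_on: "clinear_on A0 (\<lambda>x. m a x)"
    and left_mult_linear_on: "clinear_on A0 (\<lambda>x. m x a)"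
    and middle_assoc: "\<lbrakk>x \<in> A0; y \<in> A0\<rbrakk> \<Longrightarrow> m (m x a) y = m x (m a y)"
    and right_assoc: "\<lbrakk>x \<in> A0; y \<in> A0\<rbrakk> \<Longrightarrow> m a (m x y) = m (m a x) y"
    and star_add: "star (a + b) = star a + star b"
    and star_scaleC: "star (c *\<^sub>C a) = cnj c *\<^sub>C star a"
    and star_star: "star (star a) = a"
    and star_right_mult: "x \<in> A0 \<Longrightarrow> star (m a x) = m (star x) (star a)"
    and star_left_mult: "x \<in> A0 \<Longrightarrow> star (m x a) = m (star a) (star x)"
    and unit_closed: "e \<in> A0"
    and right_unit: "m a e = a"
    and left_unit: "m e a = a"

locale normed_quasi_star_algebra = quasi_star_algebra A0 m star e
  for A0 :: "'a::complex_normed_vector set" and m star e +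
  assumes norm_star: "norm (star a) = norm a"
    and dense: "closure A0 = UNIV"
    and right_mult_continuous: "x \<in> A0 \<Longrightarrow> continuous_on UNIV (\<lambda>a. m a x)"
    and norm_unit: "norm e = 1"

locale banach_quasi_star_algebra = normed_quasi_star_algebra A0 m star e
  for A0 :: "'a::cbanach set" and m star e


section \<open>The algebraic tensor product\<close>

text \<open>
  The quotient of the free complex vector space on \<open>'a \<times> 'b\<close> by the subspace spanned by the
  bilinearity relations.
\<close>

definition free_scale :: "complex \<Rightarrow> ('x \<Rightarrow>\<^sub>0 complex) \<Rightarrow> ('x \<Rightarrow>\<^sub>0 complex)"
  where "free_scale c = Poly_Mapping.map (\<lambda>z. c * z)"

abbreviation free_gen :: "'a \<Rightarrow> 'b \<Rightarrow> ('a \<times> 'b) \<Rightarrow>\<^sub>0 complex"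
  where "free_gen a b \<equiv> Poly_Mapping.single (a, b) 1"

lemma lookup_free_scale:
  "Poly_Mapping.lookup (free_scale c f) x = c * Poly_Mapping.lookup f x"
  by (simp add: free_scale_def Poly_Mapping.map.rep_eq when_def)

interpretation free: vector_space free_scale
  by unfold_locales
    (auto intro!: poly_mapping_eqI simp: lookup_free_scale lookup_add algebra_simps)

definition tensor_relations ::
    "(('a::complex_vector \<times> 'b::complex_vector) \<Rightarrow>\<^sub>0 complex) set"
  where "tensor_relations =
      {free_gen (a + a') b - free_gen a b - free_gen a' b | a a' b. True}
    \<union> {free_gen a (b + b') - free_gen a b - free_gen a b' | a b b'. True}
    \<union> {free_gen (c *\<^sub>C a) b - free_scale c (free_gen a b) | c a b. True}
    \<union> {free_gen a (c *\<^sub>C b) - free_scale c (free_gen a b) | c a b. True}"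

definition tensor_rel ::
    "(('a::complex_vector \<times> 'b::complex_vector) \<Rightarrow>\<^sub>0 complex)
      \<Rightarrow> (('a \<times> 'b) \<Rightarrow>\<^sub>0 complex) \<Rightarrow> bool"
  where "tensor_rel f g \<longleftrightarrow> f - g \<in> module.span free_scale tensor_relations"

lemma equivp_tensor_rel: 
  "equivp (tensor_rel :: (('a::complex_vector \<times> 'b::complex_vector) \<Rightarrow>\<^sub>0 complex) \<Rightarrow> _)" (is "equivp ?R")
proof (rule equivpI)
  show "reflp ?R"
    by (rule reflpI) (simp add: tensor_rel_def free.span_zero)
  show "symp ?R"
  proof (rule sympI)
    fix f g
    assume "?R f g"
    then show "?R g f"
      using free.span_neg[of "f - g"] by (simp add: tensor_rel_def)
  qed
  show "transp ?R"
  proof (rule transpI)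
    fix f g h
    assume "?R f g" "?R g h"
    then show "?R f h"
      using free.span_add[of "f - g" _ "g - h"] by (simp add: tensor_rel_def)
  qed
qed

quotient_type (overloaded) ('a, 'b) tensor =
  "('a::complex_vector \<times> 'b::complex_vector) \<Rightarrow>\<^sub>0 complex" / tensor_rel
  by (rule equivp_tensor_rel)

instantiation tensor :: (complex_vector, complex_vector) complex_vector
begin

lift_definition zero_tensor :: "('a, 'b) tensor" is 0 .

lift_definition plus_tensor :: "('a, 'b) tensor \<Rightarrow> ('a, 'b) tensor \<Rightarrow> ('a, 'b) tensor" is "(+)"
proof -
  fix f g f' g' :: "('a \<times> 'b) \<Rightarrow>\<^sub>0 complex"
  assume "tensor_rel f g" "tensor_rel f' g'"
  then show "tensor_rel (f + f') (g + g')"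
    using free.span_add[of "f - g" _ "f' - g'"] by (simp add: tensor_rel_def algebra_simps)
qed

lift_definition minus_tensor :: "('a, 'b) tensor \<Rightarrow> ('a, 'b) tensor \<Rightarrow> ('a, 'b) tensor" is "(-)"
proof -
  fix f g f' g' :: "('a \<times> 'b) \<Rightarrow>\<^sub>0 complex"
  assume "tensor_rel f g" "tensor_rel f' g'"
  then show "tensor_rel (f - f') (g - g')"
    using free.span_diff[of "f - g" _ "f' - g'"] by (simp add: tensor_rel_def algebra_simps)
qed

lift_definition uminus_tensor :: "('a, 'b) tensor \<Rightarrow> ('a, 'b) tensor" is uminus
proof -
  fix f g :: "('a \<times> 'b) \<Rightarrow>\<^sub>0 complex"
  assume "tensor_rel f g"
  then show "tensor_rel (- f) (- g)"
    using free.span_neg[of "f - g"] by (simp add: tensor_rel_def algebra_simps)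
qed

lift_definition scaleC_tensor :: "complex \<Rightarrow> ('a, 'b) tensor \<Rightarrow> ('a, 'b) tensor" is free_scale
proof -
  fix c and f g :: "('a \<times> 'b) \<Rightarrow>\<^sub>0 complex"
  assume "tensor_rel f g"
  then show "tensor_rel (free_scale c f) (free_scale c g)"
    using free.span_scale[of "f - g" _ c]
    by (simp add: tensor_rel_def free.scale_right_diff_distrib)
qed

definition scaleR_tensor :: "real \<Rightarrow> ('a, 'b) tensor \<Rightarrow> ('a, 'b) tensor"
  where "scaleR_tensor r c = complex_of_real r *\<^sub>C c"

instance
proof
  fix u v w :: "('a, 'b) tensor" and c d :: complex and r s :: real
  have tensor_rel_refl: "tensor_rel f f" for f :: "('a \<times> 'b) \<Rightarrow>\<^sub>0 complex"
    by (simp add: tensor_rel_def free.span_zero)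
  show "u + v + w = u + (v + w)"
    by transfer (simp add: tensor_rel_refl add.assoc)
  show "u + v = v + u"
    by transfer (simp add: tensor_rel_refl add.commute)
  show "0 + u = u"
    by transfer (simp add: tensor_rel_refl)
  show "- u + u = 0"
    by transfer (simp add: tensor_rel_refl)
  show "u - v = u + - v"
    by transfer (simp add: tensor_rel_refl)
  show radd: "c *\<^sub>C (u + v) = c *\<^sub>C u + c *\<^sub>C v" for c :: complex
    by transfer (simp add: tensor_rel_refl free.scale_right_distrib)
  show ladd: "(c + d) *\<^sub>C u = c *\<^sub>C u + d *\<^sub>C u" for c d :: complex
    by transfer (simp add: tensor_rel_refl free.scale_left_distrib)
  show assoc: "c *\<^sub>C d *\<^sub>C u = (c * d) *\<^sub>C u" for c d :: complex
    by transfer (simp only: free.scale_scale tensor_rel_refl)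
  show one: "1 *\<^sub>C u = u"
    by transfer (simp only: free.scale_one tensor_rel_refl)
  show "r *\<^sub>R u = complex_of_real r *\<^sub>C u"
    by (simp add: scaleR_tensor_def)
  show "r *\<^sub>R (u + v) = r *\<^sub>R u + r *\<^sub>R v"
    by (simp add: scaleR_tensor_def radd)
  show "(r + s) *\<^sub>R u = r *\<^sub>R u + s *\<^sub>R u"
    by (simp add: scaleR_tensor_def ladd)
  show "r *\<^sub>R s *\<^sub>R u = (r * s) *\<^sub>R u"
    by (simp add: scaleR_tensor_def assoc)
  show "1 *\<^sub>R u = u"
    by (simp add: scaleR_tensor_def one)
qed

end

lift_definition tensor ::
    "'a::complex_vector \<Rightarrow> 'b::complex_vector \<Rightarrow> ('a, 'b) tensor"  (infixr \<open>\<otimes>\<close> 70)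
  is free_gen .

lemma tensor_relations_zero:
  "f - g \<in> tensor_relations \<Longrightarrow> abs_tensor f = abs_tensor g"
  by (simp add: tensor.abs_eq_iff tensor_rel_def free.span_base)

lemma tensor_add_left: "(a + a') \<otimes> b = a \<otimes> b + a' \<otimes> b"
  unfolding tensor.abs_eq plus_tensor.abs_eq
  by (rule tensor_relations_zero, unfold tensor_relations_def diff_diff_eq[symmetric]) blast

lemma tensor_add_right: "a \<otimes> (b + b') = a \<otimes> b + a \<otimes> b'"
  unfolding tensor.abs_eq plus_tensor.abs_eq
  by (rule tensor_relations_zero, unfold tensor_relations_def diff_diff_eq[symmetric]) blast

lemma tensor_scaleC_left: "(c *\<^sub>C a) \<otimes> b = c *\<^sub>C (a \<otimes> b)"
  unfolding tensor.abs_eq scaleC_tensor.abs_eq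
  by (rule tensor_relations_zero, unfold tensor_relations_def) blast

lemma tensor_scaleC_right: "a \<otimes> (c *\<^sub>C b) = c *\<^sub>C (a \<otimes> b)"
  unfolding tensor.abs_eq scaleC_tensor.abs_eq
  by (rule tensor_relations_zero, unfold tensor_relations_def) blast

text \<open>
  The map \<open>\<Sum>\<^sub>i t a\<^sub>i b\<^sub>i \<mapsto> \<Sum>\<^sub>i g a\<^sub>i b\<^sub>i\<close>, where the \<open>(a\<^sub>i, b\<^sub>i)\<close> range over \<open>S\<close> and \<open>t\<close> is the
  tensor map in question. Scalars are absorbed into the factors, so that antilinear pairs such as
  two involutions are covered too.
\<close>

definition tensor_extension ::
    "('a \<Rightarrow> 'b \<Rightarrow> 't::monoid_add) \<Rightarrow> ('a \<times> 'b) set \<Rightarrow> ('a \<Rightarrow> 'b \<Rightarrow> 'w::monoid_add) \<Rightarrow> 't \<Rightarrow> 'w"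
  where "tensor_extension t S g u =
    (THE w. \<exists>ps. set ps \<subseteq> S \<and> u = (\<Sum>(a, b)\<leftarrow>ps. t a b) \<and> w = (\<Sum>(a, b)\<leftarrow>ps. g a b))"

text \<open>
  Extensions from the whole algebraic tensor product are well defined; \<open>\<sigma>\<close> is the identity for
  bilinear \<open>g\<close> and complex conjugation for antilinear pairs.
\<close>

lemma tensor_extension_sum:
  fixes g :: "'a::complex_vector \<Rightarrow> 'b::complex_vector \<Rightarrow> 'w::complex_vector"
  assumes \<sigma>: "\<And>c d. \<sigma> (c + d) = \<sigma> c + \<sigma> d" "\<And>c d. \<sigma> (c * d) = \<sigma> c * \<sigma> d" "\<sigma> 1 = 1"
    and g: "\<And>a a' b. g (a + a') b = g a b + g a' b" "\<And>a b b'. g a (b + b') = g a b + g a b'"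
      "\<And>c a b. g (c *\<^sub>C a) b = \<sigma> c *\<^sub>C g a b" "\<And>c a b. g a (c *\<^sub>C b) = \<sigma> c *\<^sub>C g a b"
  shows "tensor_extension tensor UNIV g (\<Sum>(a, b)\<leftarrow>ps. a \<otimes> b) = (\<Sum>(a, b)\<leftarrow>ps. g a b)"
proof -
  have \<sigma>0: "\<sigma> 0 = 0"
    using \<sigma>(1)[of 0 0] by simp
  define L where "L f = (\<Sum>p\<in>Poly_Mapping.keys f. \<sigma> (Poly_Mapping.lookup f p) *\<^sub>C g (fst p) (snd p))"
    for f :: "('a \<times> 'b) \<Rightarrow>\<^sub>0 complex"
  have L_superset: "L f = (\<Sum>p\<in>K. \<sigma> (Poly_Mapping.lookup f p) *\<^sub>C g (fst p) (snd p))"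
    if "finite K" "Poly_Mapping.keys f \<subseteq> K" for f K
    unfolding L_def
    by (rule sum.mono_neutral_left) (use that in \<open>auto simp: in_keys_iff \<sigma>0\<close>)
  have L_add: "L (f + f') = L f + L f'" for f f'
  proof -
    let ?K = "Poly_Mapping.keys f \<union> Poly_Mapping.keys f'"
    have "finite ?K" "Poly_Mapping.keys (f + f') \<subseteq> ?K"
      by (simp_all add: keys_add)
    then show ?thesis
      by (simp add: L_superset[of ?K] lookup_add \<sigma> scaleC_add_left sum.distrib)
  qed
  have L_scale: "L (free_scale c f) = \<sigma> c *\<^sub>C L f" for c f
  proof -
    have "Poly_Mapping.keys (free_scale c f) \<subseteq> Poly_Mapping.keys f"
      by (auto simp: in_keys_iff lookup_free_scale)
    then show ?thesis
      by (simp add: L_superset[of "Poly_Mapping.keys f"] lookup_free_scale \<sigma>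
          complex_vector.scale_sum_right scaleC_scaleC)
  qed
  have L_zero: "L 0 = 0"
    by (simp add: L_def)
  have L_diff: "L (f - f') = L f - L f'" for f f'
    using L_add[of "f - f'" f'] by simp
  have L_gen: "L (free_gen a b) = g a b" for a b
    by (simp add: L_def \<sigma> scaleC_one)
  have L_span: "L f = 0" if "f \<in> module.span free_scale tensor_relations" for f
    using that
  proof (rule free.span_induct)
    show "free.subspace {f. L f = 0}"
      by (simp add: free.subspace_def L_zero L_add L_scale)
    show "L r = 0" if "r \<in> tensor_relations" for r
      using that by (auto simp: tensor_relations_def L_diff L_gen L_scale g)
  qed
  have L_eq: "L f = L f'" if "abs_tensor f = abs_tensor f'" for f f'
    using L_span[of "f - f'"] that by (simp add: tensor.abs_eq_iff tensor_rel_def L_diff)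
  have abs_sum: "abs_tensor (\<Sum>(a, b)\<leftarrow>qs. free_gen a b) = (\<Sum>(a, b)\<leftarrow>qs. a \<otimes> b)" for qs
    by (induction qs) (auto simp: zero_tensor_def tensor.abs_eq simp flip: plus_tensor.abs_eq)
  have L_sum: "L (\<Sum>(a, b)\<leftarrow>qs. free_gen a b) = (\<Sum>(a, b)\<leftarrow>qs. g a b)" for qs
    by (induction qs) (auto simp: L_zero L_add L_gen)
  show ?thesis
    unfolding tensor_extension_def
  proof (rule the_equality)
    show "\<exists>qs. set qs \<subseteq> UNIV \<and> (\<Sum>(a, b)\<leftarrow>ps. a \<otimes> b) = (\<Sum>(a, b)\<leftarrow>qs. a \<otimes> b)
        \<and> (\<Sum>(a, b)\<leftarrow>ps. g a b) = (\<Sum>(a, b)\<leftarrow>qs. g a b)"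
      by blast
    show "w = (\<Sum>(a, b)\<leftarrow>ps. g a b)"
      if "\<exists>qs. set qs \<subseteq> UNIV \<and> (\<Sum>(a, b)\<leftarrow>ps. a \<otimes> b) = (\<Sum>(a, b)\<leftarrow>qs. a \<otimes> b)
        \<and> w = (\<Sum>(a, b)\<leftarrow>qs. g a b)" for w
      using that L_eq by (metis abs_sum L_sum)
  qed
qed

definition tensor_map ::
    "('a \<Rightarrow> 'c) \<Rightarrow> ('b \<Rightarrow> 'd) \<Rightarrow> ('a::complex_vector, 'b::complex_vector) tensor
      \<Rightarrow> ('c::complex_vector, 'd::complex_vector) tensor"
  where "tensor_map f g = tensor_extension tensor UNIV (\<lambda>a b. f a \<otimes> g b)"

definition tensor_subspace ::
    "'a::complex_vector set \<Rightarrow> 'b::complex_vector set \<Rightarrow> ('a, 'b) tensor set"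
  where "tensor_subspace V W = cspan {x \<otimes> y | x y. x \<in> V \<and> y \<in> W}"

text \<open>
  \<open>(a \<otimes> b)(x \<otimes> y) = ax \<otimes> by\<close> and \<open>(x \<otimes> y)(a \<otimes> b) = xa \<otimes> yb\<close> for \<open>x \<in> A0\<close>, \<open>y \<in> B0\<close>; as in a
  quasi *-algebra only products with a factor in \<open>A0 \<otimes> B0\<close> are meaningful.
\<close>

definition tensor_mult ::
    "'a::complex_vector set \<Rightarrow> ('a \<Rightarrow> 'a \<Rightarrow> 'a) \<Rightarrow> 'b::complex_vector set \<Rightarrow> ('b \<Rightarrow> 'b \<Rightarrow> 'b)
      \<Rightarrow> ('a, 'b) tensor \<Rightarrow> ('a, 'b) tensor \<Rightarrow> ('a, 'b) tensor"
  where "tensor_mult A0 m B0 m' u v =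
    (if v \<in> tensor_subspace A0 B0
     then tensor_extension tensor (A0 \<times> B0) (\<lambda>x y. tensor_map (\<lambda>a. m a x) (\<lambda>b. m' b y) u) v
     else tensor_extension tensor (A0 \<times> B0) (\<lambda>x y. tensor_map (\<lambda>a. m x a) (\<lambda>b. m' y b) v) u)"


section \<open>Uniform cross-norms\<close>

locale uniform_cross_norm =
  fixes n :: "('a::complex_normed_vector, 'b::complex_normed_vector) tensor \<Rightarrow> real"
  assumes nonneg: "n u \<ge> 0"
    and eq_zero_iff: "n u = 0 \<longleftrightarrow> u = 0"
    and triangle: "n (u + v) \<le> n u + n v"
    and scale: "n (c *\<^sub>C u) = cmod c * n u"
    and cross: "n (a \<otimes> b) = norm a * norm b"
    and bounded: "\<lbrakk>bounded_clinear T; bounded_clinear S\<rbrakk> \<Longrightarrow> \<exists>K. \<forall>u. n (tensor_map T S u) \<le> K * n u"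
    \<comment> \<open>An element of the completion is represented by a Cauchy sequence \<open>X\<close> and has norm
        \<open>lim n (X k)\<close>; the extended operator acts on \<open>X\<close> termwise.\<close>
    and uniform: "\<lbrakk>bounded_clinear T; bounded_clinear S;
        Metric_space.MCauchy UNIV (\<lambda>u v. n (u - v)) X\<rbrakk>
      \<Longrightarrow> lim (\<lambda>k. n (tensor_map T S (X k))) \<le> onorm T * onorm S * lim (\<lambda>k. n (X k))"

definition norm_topology :: "('t::ab_group_add \<Rightarrow> real) \<Rightarrow> 't topology"
  where "norm_topology n = Metric_space.mtopology UNIV (\<lambda>u v. n (u - v))"


section \<open>Unbounded operators\<close>

text \<open>
  An operator \<open>T : D \<rightarrow> H\<close> is represented by the total function that is \<open>0\<close> outside \<open>D\<close>, so that
  equality of operators is equality of functions and the vector space operations are pointwise.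
\<close>

definition operator_on :: "'h::complex_vector set \<Rightarrow> ('h \<Rightarrow> 'h) \<Rightarrow> bool"
  where "operator_on D T \<longleftrightarrow> clinear_on D T \<and> (\<forall>\<xi>. \<xi> \<notin> D \<longrightarrow> T \<xi> = 0)"

definition closable :: "'h::complex_normed_vector set \<Rightarrow> ('h \<Rightarrow> 'h) \<Rightarrow> bool"
  where "closable D T \<longleftrightarrow> single_valued (closure {(\<xi>, T \<xi>) | \<xi>. \<xi> \<in> D})"

definition adj_dom :: "'h::complex_inner set \<Rightarrow> ('h \<Rightarrow> 'h) \<Rightarrow> 'h set"
  where "adj_dom D T = {\<eta>. \<exists>\<zeta>. \<forall>\<xi>\<in>D. cinner (T \<xi>) \<eta> = cinner \<xi> \<zeta>}"

definition adj :: "'h::complex_inner set \<Rightarrow> ('h \<Rightarrow> 'h) \<Rightarrow> 'h \<Rightarrow> 'h"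
  where "adj D T \<eta> = (THE \<zeta>. \<forall>\<xi>\<in>D. cinner (T \<xi>) \<eta> = cinner \<xi> \<zeta>)"

definition Ldag :: "'h::chilbert_space set \<Rightarrow> ('h \<Rightarrow> 'h) set"
  where "Ldag D = {T. operator_on D T \<and> closable D T \<and> D \<subseteq> adj_dom D T}"

definition dag :: "'h::chilbert_space set \<Rightarrow> ('h \<Rightarrow> 'h) \<Rightarrow> 'h \<Rightarrow> 'h"
  where "dag D T = (\<lambda>\<xi>. if \<xi> \<in> D then adj D T \<xi> else 0)"

definition weak_mult_defined ::
    "'h::chilbert_space set \<Rightarrow> ('h \<Rightarrow> 'h) \<Rightarrow> ('h \<Rightarrow> 'h) \<Rightarrow> bool"
  where "weak_mult_defined D T S \<longleftrightarrow>
    S ` D \<subseteq> adj_dom D (dag D T) \<and> dag D T ` D \<subseteq> adj_dom D S"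

definition weak_mult ::
    "'h::chilbert_space set \<Rightarrow> ('h \<Rightarrow> 'h) \<Rightarrow> ('h \<Rightarrow> 'h) \<Rightarrow> 'h \<Rightarrow> 'h"
  where "weak_mult D T S = (\<lambda>\<xi>. if \<xi> \<in> D then adj D (dag D T) (S \<xi>) else 0)"

text \<open>
  The topology \<open>\<tau>\<^sub>w\<close> on \<open>Ldag D\<close> generated by the seminorm balls
  \<open>{S. \<bar>\<langle>(S - T)\<xi> | \<eta>\<rangle>\<bar> < r}\<close>, \<open>\<xi>, \<eta> \<in> D\<close>.
\<close>

definition weak_topology :: "'h::chilbert_space set \<Rightarrow> ('h \<Rightarrow> 'h) topology"
  where "weak_topology D = topology_generated_by
    {{S \<in> Ldag D. cmod (cinner (S \<xi> - T \<xi>) \<eta>) < r} | T \<xi> \<eta> r.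
      T \<in> Ldag D \<and> \<xi> \<in> D \<and> \<eta> \<in> D \<and> r > 0}"


section \<open>*-representations\<close>

locale star_representation =
  fixes A0 :: "'a::complex_vector set"
    and m :: "'a \<Rightarrow> 'a \<Rightarrow> 'a"
    and star :: "'a \<Rightarrow> 'a"
    and e :: 'a
    and D :: "'h::chilbert_space set"
    and \<pi> :: "'a \<Rightarrow> 'h \<Rightarrow> 'h"
  assumes domain_subspace: "csubspace D"
    and domain_dense: "closure D = UNIV"
    and maps_to: "\<pi> a \<in> Ldag D"
    and add: "\<pi> (a + b) = (\<lambda>\<xi>. \<pi> a \<xi> + \<pi> b \<xi>)"
    and scaleC: "\<pi> (c *\<^sub>C a) = (\<lambda>\<xi>. c *\<^sub>C \<pi> a \<xi>)"
    and star: "\<pi> (star a) = dag D (\<pi> a)"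
    and mult_defined: "x \<in> A0 \<Longrightarrow> weak_mult_defined D (\<pi> a) (\<pi> x)"
    and mult: "x \<in> A0 \<Longrightarrow> weak_mult D (\<pi> a) (\<pi> x) = \<pi> (m a x)"
    and unit: "\<pi> e = (\<lambda>\<xi>. if \<xi> \<in> D then \<xi> else 0)"


section \<open>Hilbert space tensor products and tensor products of representations\<close>

text \<open>
  The Hilbert space \<open>'l\<close> with the map \<open>h\<close> is a completion of the algebraic tensor product of \<open>'h\<close>
  and \<open>'k\<close> for the inner product \<open>\<langle>\<xi> \<otimes> \<eta> | \<xi>' \<otimes> \<eta>'\<rangle> = \<langle>\<xi> | \<xi>'\<rangle> \<langle>\<eta> | \<eta>'\<rangle>\<close>. This determines it up to a
  unique unitary compatible with the tensor maps.
\<close>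

locale hilbert_tensor_product =
  fixes h :: "'h::chilbert_space \<Rightarrow> 'k::chilbert_space \<Rightarrow> 'l::chilbert_space"
  assumes linear_left: "clinear (\<lambda>\<xi>. h \<xi> \<eta>)"
    and linear_right: "clinear (\<lambda>\<eta>. h \<xi> \<eta>)"
    and cinner_tensor: "cinner (h \<xi> \<eta>) (h \<xi>' \<eta>') = cinner \<xi> \<xi>' * cinner \<eta> \<eta>'"
    and dense: "closure (cspan {h \<xi> \<eta> | \<xi> \<eta>. True}) = UNIV"

definition domain_tensor ::
    "('h \<Rightarrow> 'k \<Rightarrow> 'l::complex_vector) \<Rightarrow> 'h set \<Rightarrow> 'k set \<Rightarrow> 'l set"
  where "domain_tensor h D1 D2 = cspan {h \<xi> \<eta> | \<xi> \<eta>. \<xi> \<in> D1 \<and> \<eta> \<in> D2}"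

definition operator_tensor ::
    "('h \<Rightarrow> 'k \<Rightarrow> 'l::complex_vector) \<Rightarrow> 'h set \<Rightarrow> 'k set \<Rightarrow> ('h \<Rightarrow> 'h) \<Rightarrow> ('k \<Rightarrow> 'k) \<Rightarrow> 'l \<Rightarrow> 'l"
  where "operator_tensor h D1 D2 T S = (\<lambda>\<zeta>.
    if \<zeta> \<in> domain_tensor h D1 D2
    then tensor_extension h (D1 \<times> D2) (\<lambda>\<xi> \<eta>. h (T \<xi>) (S \<eta>)) \<zeta> else 0)"

definition representation_tensor ::
    "('h \<Rightarrow> 'k \<Rightarrow> 'l::complex_vector) \<Rightarrow> 'h set \<Rightarrow> 'k set
      \<Rightarrow> ('a \<Rightarrow> 'h \<Rightarrow> 'h) \<Rightarrow> ('b \<Rightarrow> 'k \<Rightarrow> 'k)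
      \<Rightarrow> ('a::complex_vector, 'b::complex_vector) tensor \<Rightarrow> 'l \<Rightarrow> 'l"
  where "representation_tensor h D1 D2 \<pi>1 \<pi>2 u = (\<lambda>\<zeta>.
    tensor_extension tensor UNIV (\<lambda>a b. operator_tensor h D1 D2 (\<pi>1 a) (\<pi>2 b) \<zeta>) u)"

end

theory Submission
  imports Defs
begin

text \<open>
  All identities required of \<open>\<pi>1 \<otimes> \<pi>2\<close> can be stated as equalities of matrix coefficients between
  vectors of \<open>D1 \<otimes> D2\<close>, which is dense; on simple tensors these coefficients factor into those of
  \<open>\<pi>1\<close> and \<open>\<pi>2\<close>. For continuity, the coefficient at \<open>\<xi> \<otimes> \<eta>\<close>, \<open>\<xi>' \<otimes> \<eta>'\<close> is a product functional
  \<open>\<phi> \<otimes> \<psi>\<close>, and uniformity of the norm applied to the rank-one operators \<open>\<phi>(\<cdot>) eA\<close> and \<open>\<psi>(\<cdot>) eB\<close>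
  bounds it, since \<open>eA \<otimes> eB\<close> has norm one.
\<close>

section \<open>Complex linear maps and inner products\<close>

lemma clinear_iff:
  "clinear f \<longleftrightarrow> (\<forall>x y. f (x + y) = f x + f y) \<and> (\<forall>c x. f (c *\<^sub>C x) = c *\<^sub>C f x)"
  unfolding module_hom_iff_linear[symmetric]
  by (simp add: module_hom_iff complex_vector.module_axioms)

lemma clinear_add: "clinear f \<Longrightarrow> f (x + y) = f x + f y"
  by (simp add: clinear_iff)

lemma clinear_scale: "clinear f \<Longrightarrow> f (c *\<^sub>C x) = c *\<^sub>C f x"
  by (simp add: clinear_iff)

text \<open>Passes from complex to real scalars, so that the continuity results for real bounded
  linear maps apply.\<close>

lemma clinear_imp_bounded_linear:
  assumes "clinear f" and "\<And>x. norm (f x) \<le> norm x * K"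
  shows "bounded_linear (f :: 'a::complex_normed_vector \<Rightarrow> 'b::complex_normed_vector)"
  using assms(2)
  by (intro bounded_linear_intro)
    (auto simp: clinear_add[OF assms(1)] clinear_scale[OF assms(1)] scaleR_scaleC)

lemma continuous_on_scaleC: "continuous_on S ((*\<^sub>C) c :: 'a::complex_normed_vector \<Rightarrow> 'a)"
  by (rule linear_continuous_on, rule clinear_imp_bounded_linear[where K = "cmod c"])
    (simp_all add: clinear_iff scaleC_add_right scaleC_scaleC norm_scaleC mult.commute)

lemma csubspace_closure:
  fixes V :: "'a::complex_normed_vector set"
  assumes "csubspace V"
  shows "csubspace (closure V)"
proof -
  have V: "0 \<in> V" "\<And>x y. x \<in> V \<Longrightarrow> y \<in> V \<Longrightarrow> x + y \<in> V"
    "\<And>c x. x \<in> V \<Longrightarrow> c *\<^sub>C x \<in> V"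
    using assms by (auto simp: complex_vector.subspace_def)
  \<comment> \<open>Sums are extended to the closure one argument at a time, each time by a
    translation, which is continuous.\<close>
  have left: "x + y \<in> closure V" if "x \<in> V" "y \<in> closure V" for x y
  proof -
    have "(+) x ` closure V \<subseteq> closure V"
      by (rule image_closure_subset)
        (use that V closure_subset[of V] in \<open>auto intro!: continuous_intros\<close>)
    then show ?thesis using that by blast
  qed
  have "x + y \<in> closure V" if "x \<in> closure V" "y \<in> closure V" for x y
  proof -
    have "(\<lambda>x. x + y) ` closure V \<subseteq> closure V"
      by (rule image_closure_subset) (use that left in \<open>auto intro!: continuous_intros\<close>)
    then show ?thesis using that by blast
  qed
  moreover have "c *\<^sub>C x \<in> closure V" if "x \<in> closure V" for c x
  proof -
    have "(*\<^sub>C) c ` closure V \<subseteq> closure V"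
      by (rule image_closure_subset[OF continuous_on_scaleC])
        (use V closure_subset[of V] in auto)
    then show ?thesis using that by blast
  qed
  ultimately show ?thesis
    using V(1) closure_subset[of V] by (auto simp: complex_vector.subspace_def)
qed

section \<open>Sesquilinearity, polarization and continuity of the inner product\<close>

lemma cinner_add_right: "cinner x (y + z) = cinner x y + cinner x z"
  using cinner_commute cinner_add_left by (metis complex_cnj_add)

lemma cinner_scaleC_right: "cinner x (c *\<^sub>C y) = cnj c * cinner x y"
  using cinner_commute cinner_scaleC_left by (metis complex_cnj_mult)

lemma cinner_zero_left [simp]: "cinner 0 x = 0"
  using cinner_add_left[of 0 0 x] by simp

lemma cinner_zero_right [simp]: "cinner x 0 = 0"
  using cinner_add_right[of x 0 0] by simp

lemma cinner_diff_left: "cinner (x - y) z = cinner x z - cinner y z"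
  using cinner_add_left[of "x - y" y z] by simp

lemma Re_cinner: "Re (cinner x y) = ((norm (x + y))\<^sup>2 - (norm x)\<^sup>2 - (norm y)\<^sup>2) / 2"
proof -
  have "complex_of_real ((norm (x + y))\<^sup>2)
      = of_real ((norm x)\<^sup>2) + cinner x y + cnj (cinner x y) + of_real ((norm y)\<^sup>2)"
    by (simp only: cinner_add_left cinner_add_right cinner_commute[of y x] add_ac
        flip: cinner_self)
  from arg_cong[OF this, of Re] show ?thesis by simp
qed

text \<open>The imaginary part is the real part of \<open>cinner x (\<i> *\<^sub>C y)\<close>, by
  conjugate linearity in the second argument. Continuity of the inner product in each argument thus
  reduces to that of the norm.\<close>

lemma cinner_polarization:
  "cinner x y = Complex (((norm (x + y))\<^sup>2 - (norm x)\<^sup>2 - (norm y)\<^sup>2) / 2)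
    (((norm (x + \<i> *\<^sub>C y))\<^sup>2 - (norm x)\<^sup>2 - (norm y)\<^sup>2) / 2)"
  using Re_cinner[of x y] Re_cinner[of x "\<i> *\<^sub>C y"]
  by (simp add: complex_eq_iff cinner_scaleC_right norm_scaleC)

lemma continuous_on_cinner_left [continuous_intros]:
  assumes "continuous_on S f"
  shows "continuous_on S (\<lambda>x. cinner (f x) y)"
  unfolding cinner_polarization[of _ y] by (intro continuous_intros assms) simp_all

lemma continuous_on_cinner_right [continuous_intros]:
  assumes "continuous_on S f"
  shows "continuous_on S (\<lambda>x. cinner y (f x))"
  using continuous_on_cnj[OF continuous_on_cinner_left[OF assms, of y]]
  by (simp flip: cinner_commute)

text \<open>The map sending \<open>z\<close> to \<open>cinner (x - y) z\<close> is continuous and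
  vanishes on \<open>D\<close>, hence everywhere; at \<open>z = x - y\<close> its value is the
  squared norm.\<close>

lemma cinner_eqI_dense:
  assumes "closure D = UNIV" and "\<And>z. z \<in> D \<Longrightarrow> cinner x z = cinner y z"
  shows "x = y"
proof -
  have "cinner (x - y) z = 0" for z
    by (rule continuous_constant_on_closure[of D])
      (use assms in \<open>auto intro!: continuous_intros simp: cinner_diff_left\<close>)
  then show ?thesis
    using cinner_self[of "x - y"] by simp
qed

lemma cinner_eqI_dense_right:
  assumes "closure D = UNIV" and "\<And>z. z \<in> D \<Longrightarrow> cinner z x = cinner z y"
  shows "x = y"
  using assms(1)
proof (rule cinner_eqI_dense)
  show "cinner x z = cinner y z" if "z \<in> D" for z
    using arg_cong[OF assms(2)[OF that], of cnj] by (simp flip: cinner_commute)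
qed


section \<open>Operators with a formal adjoint\<close>

text \<open>Density of \<open>D\<close> makes \<zeta> unique, as the definite description in
  \<open>adj\<close> requires.\<close>

lemma adj_eqI:
  assumes "closure D = UNIV" and "\<And>\<xi>. \<xi> \<in> D \<Longrightarrow> cinner (T \<xi>) \<eta> = cinner \<xi> \<zeta>"
  shows "adj D T \<eta> = \<zeta>"
  unfolding adj_def
  by (rule the_equality) (use assms in \<open>auto intro: cinner_eqI_dense_right[of D]\<close>)

lemma cinner_adj:
  assumes "closure D = UNIV" and "\<eta> \<in> adj_dom D T" and "\<xi> \<in> D"
  shows "cinner (T \<xi>) \<eta> = cinner \<xi> (adj D T \<eta>)"
  using assms adj_eqI[of D T \<eta>] by (fastforce simp: adj_dom_def)

lemma cinner_dag:
  assumes "closure D = UNIV" and "T \<in> Ldag D" and "\<xi> \<in> D" and "\<eta> \<in> D"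
  shows "cinner (T \<xi>) \<eta> = cinner \<xi> (dag D T \<eta>)"
  using assms cinner_adj[of D \<eta> T \<xi>] by (auto simp: Ldag_def dag_def)

lemma dag_eqI:
  assumes "closure D = UNIV" and "\<And>\<xi>. \<xi> \<notin> D \<Longrightarrow> S \<xi> = 0"
    and "\<And>\<xi> \<eta>. \<lbrakk>\<xi> \<in> D; \<eta> \<in> D\<rbrakk> \<Longrightarrow> cinner (T \<xi>) \<eta> = cinner \<xi> (S \<eta>)"
  shows "dag D T = S"
  using assms by (auto simp: dag_def fun_eq_iff intro!: adj_eqI)

text \<open>A formal adjoint on a dense domain also settles closability. The adjoint relation
  between \<open>x\<close> and \<open>y\<close> is a closed condition, so it survives in the closure
  of the graph, and there it determines \<open>y\<close> from \<open>x\<close>.\<close>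

lemma LdagI:
  assumes dense: "closure D = UNIV" and T: "operator_on D T"
    and adjoint: "\<And>\<xi> \<eta>. \<lbrakk>\<xi> \<in> D; \<eta> \<in> D\<rbrakk> \<Longrightarrow> cinner (T \<xi>) \<eta> = cinner \<xi> (S \<eta>)"
  shows "T \<in> Ldag D"
proof -
  have "cinner y \<eta> = cinner x (S \<eta>)"
    if "(x, y) \<in> closure {(\<xi>, T \<xi>) | \<xi>. \<xi> \<in> D}" and "\<eta> \<in> D" for x y \<eta>
  proof -
    have "closed {p. cinner (snd p) \<eta> = cinner (fst p) (S \<eta>)}"
      by (intro closed_Collect_eq continuous_intros)
    then have "closure {(\<xi>, T \<xi>) | \<xi>. \<xi> \<in> D} \<subseteq> {p. cinner (snd p) \<eta> = cinner (fst p) (S \<eta>)}"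
      by (intro closure_minimal) (use adjoint that(2) in auto)
    then show ?thesis
      using that(1) by auto
  qed
  then have "closable D T"
    unfolding closable_def single_valued_def
    by (intro allI impI cinner_eqI_dense[OF dense]) simp
  moreover have "D \<subseteq> adj_dom D T"
    using adjoint by (auto simp: adj_dom_def)
  ultimately show ?thesis
    using T by (simp add: Ldag_def)
qed

lemma Ldag_scaleC: "\<lbrakk>T \<in> Ldag D; \<xi> \<in> D\<rbrakk> \<Longrightarrow> T (c *\<^sub>C \<xi>) = c *\<^sub>C T \<xi>"
  by (simp add: Ldag_def operator_on_def clinear_on_def)

context star_representation
begin

lemma zero_in_domain: "0 \<in> D"
  using domain_subspace by (simp add: complex_vector.subspace_def)

lemma add_apply: "\<pi> (a + b) \<xi> = \<pi> a \<xi> + \<pi> b \<xi>"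
  by (simp add: add)

lemma scaleC_apply: "\<pi> (c *\<^sub>C a) \<xi> = c *\<^sub>C \<pi> a \<xi>"
  by (simp add: scaleC)

lemma unit_apply: "\<xi> \<in> D \<Longrightarrow> \<pi> e \<xi> = \<xi>"
  by (simp add: unit)

lemma cinner_star:
  assumes "\<xi> \<in> D" and "\<eta> \<in> D"
  shows "cinner (\<pi> a \<xi>) \<eta> = cinner \<xi> (\<pi> (star a) \<eta>)"
  unfolding star by (rule cinner_dag[OF domain_dense maps_to assms])

text \<open>The weak product applies the adjoint of \<open>dag D (\<pi> a)\<close>, which is
  \<open>\<pi> (star a)\<close>, to \<open>\<pi> x \<xi>\<close>; pairing with \<eta> removes that
  adjoint.\<close>

lemma cinner_mult:
  assumes "x \<in> A0" and "\<xi> \<in> D" and "\<eta> \<in> D"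
  shows "cinner (\<pi> (star a) \<eta>) (\<pi> x \<xi>) = cinner \<eta> (\<pi> (m a x) \<xi>)"
proof -
  have "\<pi> x \<xi> \<in> adj_dom D (dag D (\<pi> a))"
    using mult_defined[OF assms(1), of a] assms(2) by (auto simp: weak_mult_defined_def)
  from cinner_adj[OF domain_dense this assms(3)] show ?thesis
    using assms(2) by (simp add: star weak_mult_def flip: mult[OF assms(1)])
qed

end

text \<open>
  The weak product is encoded by the identity \<open>\<langle>\<pi>(a\<^sup>*)\<eta> | \<pi>(x)\<xi>\<rangle> = \<langle>\<eta> | \<pi>(ax)\<xi>\<rangle>\<close>, which unlike the
  domain conditions can be checked on simple tensors.
\<close>

lemma star_representationI:
  assumes subspace: "csubspace D" and dense: "closure D = UNIV"
    and linear_on: "\<And>a. operator_on D (\<pi> a)"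
    and add: "\<And>a b. \<pi> (a + b) = (\<lambda>\<xi>. \<pi> a \<xi> + \<pi> b \<xi>)"
    and scaleC: "\<And>c a. \<pi> (c *\<^sub>C a) = (\<lambda>\<xi>. c *\<^sub>C \<pi> a \<xi>)"
    and star: "\<And>a \<xi> \<eta>. \<lbrakk>\<xi> \<in> D; \<eta> \<in> D\<rbrakk> \<Longrightarrow> cinner (\<pi> a \<xi>) \<eta> = cinner \<xi> (\<pi> (star a) \<eta>)"
    and mult: "\<And>a x \<xi> \<eta>. \<lbrakk>x \<in> A0; \<xi> \<in> D; \<eta> \<in> D\<rbrakk>
      \<Longrightarrow> cinner (\<pi> (star a) \<eta>) (\<pi> x \<xi>) = cinner \<eta> (\<pi> (m a x) \<xi>)"
    and unit: "\<And>\<xi>. \<xi> \<in> D \<Longrightarrow> \<pi> e \<xi> = \<xi>"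
  shows "star_representation A0 m star e D \<pi>"
proof
  have outside: "\<pi> a \<xi> = 0" if "\<xi> \<notin> D" for a \<xi>
    using linear_on that by (simp add: operator_on_def)
  have dag: "dag D (\<pi> a) = \<pi> (star a)" for a
    by (rule dag_eqI[OF dense outside star])
  fix a x c b
  show "csubspace D" "closure D = UNIV"
    by fact+
  show "\<pi> a \<in> Ldag D"
    by (rule LdagI[OF dense linear_on star])
  show "\<pi> (a + b) = (\<lambda>\<xi>. \<pi> a \<xi> + \<pi> b \<xi>)" "\<pi> (c *\<^sub>C a) = (\<lambda>\<xi>. c *\<^sub>C \<pi> a \<xi>)"
    by (fact add scaleC)+
  show "\<pi> (star a) = dag D (\<pi> a)"
    by (simp add: dag)
  show "\<pi> e = (\<lambda>\<xi>. if \<xi> \<in> D then \<xi> else 0)"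
    by (auto simp: fun_eq_iff unit outside)
  assume x: "x \<in> A0"
  \<comment> \<open>The conjugate of the product identity, with \<open>\<pi> (m a x)\<close> moved
    to the other side, puts \<open>\<pi> (star a) \<eta>\<close> into the domain of the adjoint of
    \<open>\<pi> x\<close>. This is the second domain condition of the weak product.\<close>
  have "cinner (\<pi> x \<xi>) (\<pi> (star a) \<eta>) = cinner \<xi> (\<pi> (star (m a x)) \<eta>)"
    if "\<xi> \<in> D" "\<eta> \<in> D" for \<xi> \<eta>
    using arg_cong[OF mult[OF x that, of a], of cnj] star[OF that, of "m a x"]
    by (simp flip: cinner_commute)
  then show "weak_mult_defined D (\<pi> a) (\<pi> x)"
    using mult[OF x, of _ _ a] by (auto simp: weak_mult_defined_def dag adj_dom_def)
  show "weak_mult D (\<pi> a) (\<pi> x) = \<pi> (m a x)"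
    by (auto simp: weak_mult_def fun_eq_iff dag outside intro!: adj_eqI[OF dense] mult[OF x])
qed


section \<open>Induction on tensors and extension of bilinear maps\<close>

text \<open>Scalars can be absorbed into the first factor, so the span consists of finite sums of
  vectors \<open>t x y\<close> and induction needs no case for scalar multiples. The map
  \<open>t\<close> is arbitrary in order to cover both the algebraic tensor map and the Hilbert
  space one.\<close>

lemma cspan_bilinear_induct [consumes 1, case_names left right scale tensor add]:
  assumes "\<zeta> \<in> cspan {t x y | x y. x \<in> V \<and> y \<in> W}"
    and left: "csubspace V" and right: "csubspace W"
    and scale: "\<And>c x y. c *\<^sub>C t x y = t (c *\<^sub>C x) y"
    and gen: "\<And>x y. \<lbrakk>x \<in> V; y \<in> W\<rbrakk> \<Longrightarrow> P (t x y)"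
    and add: "\<And>u v. \<lbrakk>u \<in> cspan {t x y | x y. x \<in> V \<and> y \<in> W};
      v \<in> cspan {t x y | x y. x \<in> V \<and> y \<in> W}; P u; P v\<rbrakk> \<Longrightarrow> P (u + v)"
  shows "P \<zeta>"
proof -
  let ?G = "{t x y | x y. x \<in> V \<and> y \<in> W}"
  have "\<zeta> \<in> cspan ?G \<and> P \<zeta>"
    using assms(1)
  proof (induction rule: complex_vector.span_induct_alt)
    \<comment> \<open>Scaling by zero shows \<open>t 0 0 = 0\<close>, so the empty sum is itself of
      the form \<open>t x y\<close>.\<close>
    case base
    then show ?case
      using gen[of 0 0] scale[of 0 0 0] left right
      by (simp add: complex_vector.span_zero complex_vector.subspace_0)
  next
    case (step c u v)
    then obtain x y where xy: "x \<in> V" "y \<in> W" "u = t x y"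
      by blast
    then have cx: "c *\<^sub>C x \<in> V"
      using left by (simp add: complex_vector.subspace_scale)
    then have "t (c *\<^sub>C x) y \<in> cspan ?G"
      using xy by (auto intro!: complex_vector.span_base)
    then show ?case
      using step xy cx by (simp add: scale gen add complex_vector.span_add)
  qed
  then show ?thesis by blast
qed

text \<open>A representative in the free space is a finite sum of entries with one key, and such an
  entry with value \<open>v\<close> at \<open>(a, b)\<close> represents
  \<open>(v *\<^sub>C a) \<otimes> b\<close>.\<close>

lemma tensor_induct [case_names tensor add, induct type: tensor]:
  assumes gen: "\<And>a b. P (a \<otimes> b)" and add: "\<And>u v. \<lbrakk>P u; P v\<rbrakk> \<Longrightarrow> P (u + v)"
  shows "P u"
proof -
  obtain f where f: "u = abs_tensor f"
    by (rule that, rule sym, rule Quotient_abs_rep[OF Quotient_tensor])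
  have single: "P (abs_tensor (Poly_Mapping.single k v))" for k v
  proof -
    have "Poly_Mapping.single k v = free_scale v (free_gen (fst k) (snd k))"
      by (rule poly_mapping_eqI) (simp add: lookup_free_scale lookup_single when_def)
    then have "abs_tensor (Poly_Mapping.single k v) = (v *\<^sub>C fst k) \<otimes> snd k"
      unfolding tensor_scaleC_left unfolding tensor.abs_eq scaleC_tensor.abs_eq by (rule arg_cong)
    then show ?thesis
      using gen by simp
  qed
  have "P (abs_tensor f)"
  proof (induction f rule: update_induct)
    case const
    show ?case using single[of undefined 0] by simp
  next
    case (update f k v)
    \<comment> \<open>The key \<open>k\<close> is fresh, so the update is an addition.\<close>
    then have "Poly_Mapping.update k v f = Poly_Mapping.single k v + f"
      by (intro poly_mapping_eqI) (auto simp: lookup_update lookup_add lookup_single in_keys_iff)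
    then show ?case
      using single update by (simp add: add flip: plus_tensor.abs_eq)
  qed
  then show ?thesis
    by (simp add: f)
qed

section \<open>Linear and antilinear extension from simple tensors\<close>

lemma tensor_sum_list: "\<exists>ps. u = (\<Sum>(a, b)\<leftarrow>ps. a \<otimes> b)"
proof (induction u)
  case (tensor a b)
  then show ?case by (intro exI[of _ "[(a, b)]"]) simp
next
  case (add u v)
  then obtain ps qs where "u = (\<Sum>(a, b)\<leftarrow>ps. a \<otimes> b)" "v = (\<Sum>(a, b)\<leftarrow>qs. a \<otimes> b)"
    by blast
  then show ?case by (intro exI[of _ "ps @ qs"]) simp
qed

text \<open>The parameter \<sigma> lets bilinear maps, with \<sigma> the identity, and the pair of
  involutions, with \<sigma> = \<open>cnj\<close>, share one theory of extensions.\<close>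

locale tensor_lift =
  fixes \<sigma> :: "complex \<Rightarrow> complex"
    and g :: "'a::complex_vector \<Rightarrow> 'b::complex_vector \<Rightarrow> 'w::complex_vector"
  assumes \<sigma>: "\<And>c d. \<sigma> (c + d) = \<sigma> c + \<sigma> d" "\<And>c d. \<sigma> (c * d) = \<sigma> c * \<sigma> d" "\<sigma> 1 = 1"
    and g_add: "\<And>a a' b. g (a + a') b = g a b + g a' b"
      "\<And>a b b'. g a (b + b') = g a b + g a b'"
    and g_scaleC: "\<And>c a b. g (c *\<^sub>C a) b = \<sigma> c *\<^sub>C g a b"
      "\<And>c a b. g a (c *\<^sub>C b) = \<sigma> c *\<^sub>C g a b"
begin

abbreviation lift :: "('a, 'b) tensor \<Rightarrow> 'w"
  where "lift \<equiv> tensor_extension tensor UNIV g"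

lemma lift_sum: "lift (\<Sum>(a, b)\<leftarrow>ps. a \<otimes> b) = (\<Sum>(a, b)\<leftarrow>ps. g a b)"
  by (rule tensor_extension_sum[of \<sigma>]) (fact \<sigma> g_add g_scaleC)+

lemma lift_tensor: "lift (a \<otimes> b) = g a b"
  using lift_sum[of "[(a, b)]"] by simp

lemma lift_add: "lift (u + v) = lift u + lift v"
proof -
  obtain ps qs where "u = (\<Sum>(a, b)\<leftarrow>ps. a \<otimes> b)" "v = (\<Sum>(a, b)\<leftarrow>qs. a \<otimes> b)"
    using tensor_sum_list by blast
  then show ?thesis
    using lift_sum[of "ps @ qs"] by (simp add: lift_sum)
qed

lemma lift_scaleC: "lift (c *\<^sub>C u) = \<sigma> c *\<^sub>C lift u"
proof (induction u)
  case (tensor a b)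
  show ?case
    by (simp add: lift_tensor g_scaleC flip: tensor_scaleC_left)
qed (simp add: scaleC_add_right lift_add)

text \<open>An expansion over pairs from \<open>S\<close> is in particular an expansion over all
  pairs, and the value of \<open>lift\<close> does not depend on the expansion. Hence
  \<open>f\<close> matters only through its agreement with \<open>g\<close> on
  \<open>S\<close>.\<close>

lemma tensor_extension_eq_lift:
  assumes u: "u = (\<Sum>(a, b)\<leftarrow>ps. a \<otimes> b)" "set ps \<subseteq> S"
    and f: "\<And>a b. (a, b) \<in> S \<Longrightarrow> f a b = g a b"
  shows "tensor_extension tensor S f u = lift u"
proof -
  have eq: "(\<Sum>(a, b)\<leftarrow>qs. f a b) = (\<Sum>(a, b)\<leftarrow>qs. g a b)" if "set qs \<subseteq> S" for qs
    using that f by (intro arg_cong[of _ _ sum_list] map_cong) auto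
  show ?thesis
    unfolding tensor_extension_def[of tensor S]
  proof (rule the_equality)
    show "\<exists>ps. set ps \<subseteq> S \<and> u = (\<Sum>(a, b)\<leftarrow>ps. a \<otimes> b) \<and> lift u = (\<Sum>(a, b)\<leftarrow>ps. f a b)"
      by (intro exI[of _ ps] conjI u) (simp only: u(1) lift_sum eq[OF u(2)])
    show "w = lift u"
      if w: "\<exists>ps. set ps \<subseteq> S \<and> u = (\<Sum>(a, b)\<leftarrow>ps. a \<otimes> b) \<and> w = (\<Sum>(a, b)\<leftarrow>ps. f a b)" for w
    proof -
      obtain qs where "set qs \<subseteq> S" "u = (\<Sum>(a, b)\<leftarrow>qs. a \<otimes> b)" "w = (\<Sum>(a, b)\<leftarrow>qs. f a b)"
        using w by blast
      then show ?thesis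
        by (simp only: lift_sum eq)
    qed
  qed
qed

end

lemma tensor_lift_tensor_map:
  assumes "clinear f" and "clinear g"
  shows "tensor_lift (\<lambda>c. c) (\<lambda>a b. f a \<otimes> g b)"
  by unfold_locales
    (simp_all add: clinear_add[OF assms(1)] clinear_add[OF assms(2)] clinear_scale[OF assms(1)]
      clinear_scale[OF assms(2)] tensor_add_left tensor_add_right tensor_scaleC_left
      tensor_scaleC_right)

lemma tensor_map_tensor:
  "\<lbrakk>clinear f; clinear g\<rbrakk> \<Longrightarrow> tensor_map f g (a \<otimes> b) = f a \<otimes> g b"
  unfolding tensor_map_def by (rule tensor_lift.lift_tensor[OF tensor_lift_tensor_map])

lemma tensor_map_add:
  "\<lbrakk>clinear f; clinear g\<rbrakk> \<Longrightarrow> tensor_map f g (u + v) = tensor_map f g u + tensor_map f g v"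
  unfolding tensor_map_def by (rule tensor_lift.lift_add[OF tensor_lift_tensor_map])


section \<open>The product on a tensor product of quasi *-algebras\<close>

locale quasi_star_algebra_pair =
  A: quasi_star_algebra A0 mA starA eA + B: quasi_star_algebra B0 mB starB eB
  for A0 :: "'a::complex_vector set" and mA starA eA
    and B0 :: "'b::complex_vector set" and mB starB eB
begin

lemma tensor_lift_star: "tensor_lift cnj (\<lambda>a b. starA a \<otimes> starB b)"
  by unfold_locales
    (simp_all add: A.star_add A.star_scaleC B.star_add B.star_scaleC tensor_add_left
      tensor_add_right tensor_scaleC_left tensor_scaleC_right)

lemma tensor_star_tensor: "tensor_map starA starB (a \<otimes> b) = starA a \<otimes> starB b"
  unfolding tensor_map_def by (rule tensor_lift.lift_tensor[OF tensor_lift_star])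

lemma tensor_star_add:
  "tensor_map starA starB (u + v) = tensor_map starA starB u + tensor_map starA starB v"
  unfolding tensor_map_def by (rule tensor_lift.lift_add[OF tensor_lift_star])

abbreviation mult_simple :: "('a, 'b) tensor \<Rightarrow> 'a \<Rightarrow> 'b \<Rightarrow> ('a, 'b) tensor"
  where "mult_simple u x y \<equiv> tensor_map (\<lambda>a. mA a x) (\<lambda>b. mB b y) u"

lemma mult_simple_tensor:
  "\<lbrakk>x \<in> A0; y \<in> B0\<rbrakk> \<Longrightarrow> mult_simple (a \<otimes> b) x y = mA a x \<otimes> mB b y"
  by (rule tensor_map_tensor[OF A.right_mult_linear B.right_mult_linear])

lemma mult_simple_add:
  "\<lbrakk>x \<in> A0; y \<in> B0\<rbrakk> \<Longrightarrow> mult_simple (u + v) x y = mult_simple u x y + mult_simple v x y"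
  by (rule tensor_map_add[OF A.right_mult_linear B.right_mult_linear])

text \<open>
  \<open>mult_simple u\<close> is bilinear on \<open>A0 \<times> B0\<close> only. Composing with linear projections onto \<open>A0\<close> and
  \<open>B0\<close> makes it bilinear everywhere, so its value does not depend on how an element of
  \<open>A0 \<otimes> B0 \<subseteq> \<AA> \<otimes> \<BB>\<close> is written.
\<close>

lemma tensor_mult_lift:
  obtains g where "tensor_lift (\<lambda>c. c) g"
    and "\<And>x y. \<lbrakk>x \<in> A0; y \<in> B0\<rbrakk> \<Longrightarrow> g x y = mult_simple u x y"
    and "\<And>v. v \<in> tensor_subspace A0 B0
      \<Longrightarrow> tensor_mult A0 mA B0 mB u v = tensor_extension tensor UNIV g v"
proof -
  \<comment> \<open>The inclusion of \<open>V\<close> has a linear left inverse with values in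
    \<open>V\<close>, that is, a projection onto \<open>V\<close>.\<close>
  have proj: "\<exists>p. range p \<subseteq> V \<and> clinear p \<and> (\<forall>x\<in>V. p x = x)"
    if "csubspace V" for V :: "'c::complex_vector set"
  proof -
    interpret vector_space_pair "scaleC :: complex \<Rightarrow> 'c \<Rightarrow> 'c" "scaleC :: complex \<Rightarrow> 'c \<Rightarrow> 'c" ..
    show ?thesis
      using linear_exists_left_inverse_on[of "\<lambda>x. x" V] that by (auto simp: complex_vector.linear_ident)
  qed
  obtain p where p: "range p \<subseteq> A0" "clinear p" "\<And>x. x \<in> A0 \<Longrightarrow> p x = x"
    using proj[OF A.subspace] by blast
  obtain q where q: "range q \<subseteq> B0" "clinear q" "\<And>y. y \<in> B0 \<Longrightarrow> q y = y"
    using proj[OF B.subspace] by blast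
  define g where "g u x y = mult_simple u (p x) (q y)" for u x y
  have pq: "p x \<in> A0" "q y \<in> B0" for x y
    using p(1) q(1) by auto
  have mA: "mA a (p (x + x')) = mA a (p x) + mA a (p x')" "mA a (p (c *\<^sub>C x)) = c *\<^sub>C mA a (p x)"
    for a x x' c
    using A.right_mult_linear_on[of a] pq
    by (auto simp: clinear_on_def clinear_add[OF p(2)] clinear_scale[OF p(2)])
  have mB: "mB b (q (y + y')) = mB b (q y) + mB b (q y')" "mB b (q (c *\<^sub>C y)) = c *\<^sub>C mB b (q y)"
    for b y y' c
    using B.right_mult_linear_on[of b] pq
    by (auto simp: clinear_on_def clinear_add[OF q(2)] clinear_scale[OF q(2)])
  have g_tensor: "g (a \<otimes> b) x y = mA a (p x) \<otimes> mB b (q y)" for a b x y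
    unfolding g_def by (rule mult_simple_tensor[OF pq])
  have g_add: "g (u + v) x y = g u x y + g v x y" for u v x y
    unfolding g_def by (rule mult_simple_add[OF pq])
  \<comment> \<open>Since \<open>g\<close> is additive in \<open>u\<close>, its bilinearity in
    \<open>x\<close> and \<open>y\<close> needs to be computed only for simple tensors
    \<open>u\<close>.\<close>
  have "g u (x + x') y = g u x y + g u x' y" "g u x (y + y') = g u x y + g u x y'"
    "g u (c *\<^sub>C x) y = c *\<^sub>C g u x y" "g u x (c *\<^sub>C y) = c *\<^sub>C g u x y" for x x' y y' c
    by (induction u; simp add: g_tensor g_add mA mB tensor_add_left tensor_add_right
        tensor_scaleC_left tensor_scaleC_right scaleC_add_right add_ac)+
  then have g: "tensor_lift (\<lambda>c. c) (g u)"
    by unfold_locales simp_all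
  moreover have g_eq: "g u x y = mult_simple u x y" if "x \<in> A0" "y \<in> B0" for x y
    using that by (simp add: g_def p q)
  moreover have "tensor_mult A0 mA B0 mB u v = tensor_extension tensor UNIV (g u) v"
    if v: "v \<in> tensor_subspace A0 B0" for v
  proof -
    have "\<exists>ps. v = (\<Sum>(a, b)\<leftarrow>ps. a \<otimes> b) \<and> set ps \<subseteq> A0 \<times> B0"
      using v unfolding tensor_subspace_def
    proof (induction rule: cspan_bilinear_induct)
      case (tensor x y)
      then show ?case by (intro exI[of _ "[(x, y)]"]) simp
    next
      case (add u v)
      then obtain ps qs where "u = (\<Sum>(a, b)\<leftarrow>ps. a \<otimes> b)" "set ps \<subseteq> A0 \<times> B0"
        "v = (\<Sum>(a, b)\<leftarrow>qs. a \<otimes> b)" "set qs \<subseteq> A0 \<times> B0"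
        by blast
      then show ?case by (intro exI[of _ "ps @ qs"]) simp
    qed (simp_all add: A.subspace B.subspace tensor_scaleC_left)
    then obtain ps where "v = (\<Sum>(a, b)\<leftarrow>ps. a \<otimes> b)" "set ps \<subseteq> A0 \<times> B0"
      by blast
    then have "tensor_extension tensor (A0 \<times> B0) (mult_simple u) v = tensor_extension tensor UNIV (g u) v"
      by (rule tensor_lift.tensor_extension_eq_lift[OF g]) (simp add: g_eq)
    then show ?thesis
      using v by (simp add: tensor_mult_def)
  qed
  ultimately show ?thesis
    by (rule that)
qed

lemma tensor_mult_tensor:
  assumes "x \<in> A0" and "y \<in> B0"
  shows "tensor_mult A0 mA B0 mB u (x \<otimes> y) = mult_simple u x y"
proof -
  have "x \<otimes> y \<in> tensor_subspace A0 B0"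
    using assms by (auto simp: tensor_subspace_def intro: complex_vector.span_base)
  then show ?thesis
    using assms by (metis tensor_mult_lift tensor_lift.lift_tensor)
qed

text \<open>The lift \<open>g\<close> depends on \<open>u\<close> alone, so one and the same
  additive map computes all three products.\<close>

lemma tensor_mult_add:
  assumes "v \<in> tensor_subspace A0 B0" and "w \<in> tensor_subspace A0 B0"
  shows "tensor_mult A0 mA B0 mB u (v + w)
    = tensor_mult A0 mA B0 mB u v + tensor_mult A0 mA B0 mB u w"
proof -
  have "v + w \<in> tensor_subspace A0 B0"
    using assms by (auto simp: tensor_subspace_def intro: complex_vector.span_add)
  then show ?thesis
    using assms by (metis tensor_mult_lift tensor_lift.lift_add)
qed

end


section \<open>Tensor products of operators\<close>

locale hilbert_tensor_domain = hilbert_tensor_product h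
  for h :: "'h::chilbert_space \<Rightarrow> 'k::chilbert_space \<Rightarrow> 'l::chilbert_space" +
  fixes D1 :: "'h set" and D2 :: "'k set"
  assumes subspace1: "csubspace D1" and dense1: "closure D1 = UNIV"
    and subspace2: "csubspace D2" and dense2: "closure D2 = UNIV"
begin

abbreviation D where "D \<equiv> domain_tensor h D1 D2"

lemma tensor_in_domain: "\<lbrakk>\<xi> \<in> D1; \<eta> \<in> D2\<rbrakk> \<Longrightarrow> h \<xi> \<eta> \<in> D"
  by (auto simp: domain_tensor_def intro: complex_vector.span_base)

lemma subspace_domain: "csubspace D"
  by (simp add: domain_tensor_def)

lemma domain_scaleC: "\<zeta> \<in> D \<Longrightarrow> c *\<^sub>C \<zeta> \<in> D"
  by (simp add: subspace_domain complex_vector.subspace_scale)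

lemma domain_induct [consumes 1, case_names tensor add]:
  assumes "\<zeta> \<in> D" and "\<And>\<xi> \<eta>. \<lbrakk>\<xi> \<in> D1; \<eta> \<in> D2\<rbrakk> \<Longrightarrow> P (h \<xi> \<eta>)"
    and "\<And>u v. \<lbrakk>u \<in> D; v \<in> D; P u; P v\<rbrakk> \<Longrightarrow> P (u + v)"
  shows "P \<zeta>"
  using assms(1) unfolding domain_tensor_def
  by (induction rule: cspan_bilinear_induct)
    (simp_all add: assms(2,3) subspace1 subspace2 clinear_scale[OF linear_left]
      flip: domain_tensor_def)

lemma norm_tensor: "norm (h \<xi> \<eta>) = norm \<xi> * norm \<eta>"
proof -
  have "complex_of_real ((norm (h \<xi> \<eta>))\<^sup>2) = of_real ((norm \<xi> * norm \<eta>)\<^sup>2)"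
    using cinner_tensor[of \<xi> \<eta> \<xi> \<eta>] by (simp add: cinner_self power_mult_distrib)
  then show ?thesis
    unfolding of_real_eq_iff by (simp add: power2_eq_iff_nonneg)
qed

text \<open>The norm identity makes \<open>h\<close> continuous in each variable. Density of
  \<open>D1\<close> and then of \<open>D2\<close> therefore puts every \<open>h \<xi> \<eta>\<close>
  into the closure of \<open>D\<close>, which is a subspace and so contains their dense
  span.\<close>

lemma dense_domain: "closure D = UNIV"
proof -
  have cont: "continuous_on UNIV (\<lambda>\<xi>. h \<xi> \<eta>)" "continuous_on UNIV (\<lambda>\<eta>. h \<xi> \<eta>)" for \<xi> \<eta>
    by (intro linear_continuous_on clinear_imp_bounded_linear[OF linear_left, of _ "norm \<eta>"]
        clinear_imp_bounded_linear[OF linear_right, of _ "norm \<xi>"];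
        simp add: norm_tensor mult.commute)+
  have left: "h \<xi> \<eta> \<in> closure D" if "\<eta> \<in> D2" for \<xi> \<eta>
    using image_closure_subset[of D1 "\<lambda>\<xi>. h \<xi> \<eta>" "closure D"] that cont(1)[of \<eta>] dense1
      tensor_in_domain closure_subset[of D] by auto
  have "h \<xi> \<eta> \<in> closure D" for \<xi> \<eta>
    using image_closure_subset[of D2 "\<lambda>\<eta>. h \<xi> \<eta>" "closure D"] left cont(2)[of \<xi>] dense2 by auto
  then have "cspan {h \<xi> \<eta> | \<xi> \<eta>. True} \<subseteq> closure D"
    by (intro complex_vector.span_minimal csubspace_closure subspace_domain) auto
  then show ?thesis
    using closure_minimal[of _ "closure D"] dense by auto
qed

text \<open>This is where \<open>operator_tensor\<close> is seen to be well defined: formal adjoints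
  on dense domains force any two expansions of one vector to give the same value.\<close>

lemma operator_tensor_sum:
  assumes T: "T \<in> Ldag D1" and S: "S \<in> Ldag D2" and ps: "set ps \<subseteq> D1 \<times> D2"
  shows "operator_tensor h D1 D2 T S (\<Sum>(\<xi>, \<eta>)\<leftarrow>ps. h \<xi> \<eta>) = (\<Sum>(\<xi>, \<eta>)\<leftarrow>ps. h (T \<xi>) (S \<eta>))"
proof -
  have in_D: "(\<Sum>(\<xi>, \<eta>)\<leftarrow>qs. h \<xi> \<eta>) \<in> D" if "set qs \<subseteq> D1 \<times> D2" for qs
    using that subspace_domain
    by (induction qs) (auto simp: complex_vector.subspace_def tensor_in_domain)
  \<comment> \<open>Pairing with \<open>D1 \<otimes> D2\<close> moves \<open>T \<otimes> S\<close> to the other side, where the chosen expansion is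
      invisible.\<close>
  have pair: "cinner (\<Sum>(\<xi>, \<eta>)\<leftarrow>qs. h (T \<xi>) (S \<eta>)) (h \<xi>' \<eta>')
      = cinner (\<Sum>(\<xi>, \<eta>)\<leftarrow>qs. h \<xi> \<eta>) (h (dag D1 T \<xi>') (dag D2 S \<eta>'))"
    if "set qs \<subseteq> D1 \<times> D2" "\<xi>' \<in> D1" "\<eta>' \<in> D2" for qs \<xi>' \<eta>'
    using that
    by (induction qs)
      (auto simp: cinner_add_left cinner_tensor cinner_dag[OF dense1 T] cinner_dag[OF dense2 S])
  have unique: "(\<Sum>(\<xi>, \<eta>)\<leftarrow>qs. h (T \<xi>) (S \<eta>)) = (\<Sum>(\<xi>, \<eta>)\<leftarrow>ps. h (T \<xi>) (S \<eta>))"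
    if qs: "set qs \<subseteq> D1 \<times> D2" "(\<Sum>(\<xi>, \<eta>)\<leftarrow>ps. h \<xi> \<eta>) = (\<Sum>(\<xi>, \<eta>)\<leftarrow>qs. h \<xi> \<eta>)" for qs
  proof (rule cinner_eqI_dense[OF dense_domain])
    fix z
    assume "z \<in> D"
    then show "cinner (\<Sum>(\<xi>, \<eta>)\<leftarrow>qs. h (T \<xi>) (S \<eta>)) z = cinner (\<Sum>(\<xi>, \<eta>)\<leftarrow>ps. h (T \<xi>) (S \<eta>)) z"
      by (induction rule: domain_induct) (simp_all add: pair qs ps cinner_add_right)
  qed
  have "tensor_extension h (D1 \<times> D2) (\<lambda>\<xi> \<eta>. h (T \<xi>) (S \<eta>)) (\<Sum>(\<xi>, \<eta>)\<leftarrow>ps. h \<xi> \<eta>)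
      = (\<Sum>(\<xi>, \<eta>)\<leftarrow>ps. h (T \<xi>) (S \<eta>))"
    unfolding tensor_extension_def
    by (rule the_equality) (use ps unique in blast)+
  then show ?thesis
    using in_D[OF ps] by (simp add: operator_tensor_def)
qed

lemma operator_tensor_tensor:
  assumes "T \<in> Ldag D1" and "S \<in> Ldag D2" and "\<xi> \<in> D1" and "\<eta> \<in> D2"
  shows "operator_tensor h D1 D2 T S (h \<xi> \<eta>) = h (T \<xi>) (S \<eta>)"
  using operator_tensor_sum[OF assms(1,2), of "[(\<xi>, \<eta>)]"] assms by simp

lemma operator_tensor_outside: "\<zeta> \<notin> D \<Longrightarrow> operator_tensor h D1 D2 T S \<zeta> = 0"
  by (simp add: operator_tensor_def)

lemma domain_sum_list:
  assumes "\<zeta> \<in> D"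
  obtains ps where "\<zeta> = (\<Sum>(\<xi>, \<eta>)\<leftarrow>ps. h \<xi> \<eta>)" and "set ps \<subseteq> D1 \<times> D2"
proof -
  have "\<exists>ps. \<zeta> = (\<Sum>(\<xi>, \<eta>)\<leftarrow>ps. h \<xi> \<eta>) \<and> set ps \<subseteq> D1 \<times> D2"
    using assms
  proof (induction rule: domain_induct)
    case (tensor \<xi> \<eta>)
    then show ?case by (intro exI[of _ "[(\<xi>, \<eta>)]"]) simp
  next
    case (add u v)
    then obtain ps qs where "u = (\<Sum>(\<xi>, \<eta>)\<leftarrow>ps. h \<xi> \<eta>)" "set ps \<subseteq> D1 \<times> D2"
      "v = (\<Sum>(\<xi>, \<eta>)\<leftarrow>qs. h \<xi> \<eta>)" "set qs \<subseteq> D1 \<times> D2"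
      by blast
    then show ?case by (intro exI[of _ "ps @ qs"]) simp
  qed
  then show ?thesis using that by blast
qed

lemma operator_tensor_add:
  assumes "T \<in> Ldag D1" and "S \<in> Ldag D2" and "\<zeta> \<in> D" and "\<zeta>' \<in> D"
  shows "operator_tensor h D1 D2 T S (\<zeta> + \<zeta>')
    = operator_tensor h D1 D2 T S \<zeta> + operator_tensor h D1 D2 T S \<zeta>'"
proof -
  obtain ps where "\<zeta> = (\<Sum>(\<xi>, \<eta>)\<leftarrow>ps. h \<xi> \<eta>)" "set ps \<subseteq> D1 \<times> D2"
    using domain_sum_list[OF assms(3)] .
  moreover obtain qs where "\<zeta>' = (\<Sum>(\<xi>, \<eta>)\<leftarrow>qs. h \<xi> \<eta>)" "set qs \<subseteq> D1 \<times> D2"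
    using domain_sum_list[OF assms(4)] .
  ultimately show ?thesis
    using operator_tensor_sum[OF assms(1,2), of "ps @ qs"]
    by (simp add: operator_tensor_sum[OF assms(1,2)])
qed

lemma operator_tensor_scaleC:
  assumes T: "T \<in> Ldag D1" and S: "S \<in> Ldag D2" and "\<zeta> \<in> D"
  shows "operator_tensor h D1 D2 T S (c *\<^sub>C \<zeta>) = c *\<^sub>C operator_tensor h D1 D2 T S \<zeta>"
  using assms(3)
proof (induction rule: domain_induct)
  case (tensor \<xi> \<eta>)
  then have "c *\<^sub>C \<xi> \<in> D1"
    using subspace1 by (simp add: complex_vector.subspace_def)
  then show ?case
    using operator_tensor_tensor[OF T S, of "c *\<^sub>C \<xi>" \<eta>] tensor
    by (simp add: operator_tensor_tensor[OF T S] Ldag_scaleC[OF T] clinear_scale[OF linear_left])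
next
  case (add u v)
  then show ?case
    by (simp add: scaleC_add_right operator_tensor_add[OF T S] domain_scaleC)
qed

end


section \<open>Tensor products of representations\<close>

locale star_representation_pair =
  quasi_star_algebra_pair A0 mA starA eA B0 mB starB eB +
  R1: star_representation A0 mA starA eA D1 \<pi>1 +
  R2: star_representation B0 mB starB eB D2 \<pi>2 +
  hilbert_tensor_product h
  for A0 :: "'a::complex_vector set" and mA starA eA
    and B0 :: "'b::complex_vector set" and mB starB eB
    and D1 :: "'h::chilbert_space set" and \<pi>1
    and D2 :: "'k::chilbert_space set" and \<pi>2
    and h :: "'h \<Rightarrow> 'k \<Rightarrow> 'l::chilbert_space"
begin

sublocale hilbert_tensor_domain h D1 D2
  by unfold_locales
    (fact R1.domain_subspace R1.domain_dense R2.domain_subspace R2.domain_dense)+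

abbreviation \<pi> where "\<pi> \<equiv> representation_tensor h D1 D2 \<pi>1 \<pi>2"

definition op where "op a b = operator_tensor h D1 D2 (\<pi>1 a) (\<pi>2 b)"

lemmas op_tensor = operator_tensor_tensor[OF R1.maps_to R2.maps_to, folded op_def]
lemmas op_add = operator_tensor_add[OF R1.maps_to R2.maps_to, folded op_def]
lemmas op_scaleC = operator_tensor_scaleC[OF R1.maps_to R2.maps_to, folded op_def]

lemma op_outside: "\<zeta> \<notin> D \<Longrightarrow> op a b \<zeta> = 0"
  by (simp add: op_def operator_tensor_outside)

text \<open>Bilinearity in the algebra elements at a fixed vector is what makes \<pi> well defined
  on the algebraic tensor product. By additivity in \<zeta> it reduces to vectors
  \<open>h \<xi> \<eta>\<close>, and outside \<open>D\<close> all values are zero.\<close>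

lemma tensor_lift_op: "tensor_lift (\<lambda>c. c) (\<lambda>a b. op a b \<zeta>)"
proof (cases "\<zeta> \<in> D")
  case True
  have "op (a + a') b \<zeta> = op a b \<zeta> + op a' b \<zeta>" "op a (b + b') \<zeta> = op a b \<zeta> + op a b' \<zeta>"
    "op (c *\<^sub>C a) b \<zeta> = c *\<^sub>C op a b \<zeta>" "op a (c *\<^sub>C b) \<zeta> = c *\<^sub>C op a b \<zeta>" for a a' b b' c
    using True
    by (induction rule: domain_induct;
        simp add: op_tensor op_add R1.add_apply R2.add_apply R1.scaleC_apply R2.scaleC_apply
          scaleC_add_right clinear_add[OF linear_left] clinear_add[OF linear_right]
          clinear_scale[OF linear_left] clinear_scale[OF linear_right])+
  then show ?thesis
    by unfold_locales simp_all
next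
  case False
  then show ?thesis
    by unfold_locales (simp_all add: op_outside)
qed

lemma rep_tensor: "\<pi> (a \<otimes> b) \<zeta> = op a b \<zeta>"
  unfolding representation_tensor_def op_def[symmetric]
  by (rule tensor_lift.lift_tensor[OF tensor_lift_op])

lemma rep_add: "\<pi> (u + v) \<zeta> = \<pi> u \<zeta> + \<pi> v \<zeta>"
  unfolding representation_tensor_def op_def[symmetric]
  by (rule tensor_lift.lift_add[OF tensor_lift_op])

lemma rep_scaleC: "\<pi> (c *\<^sub>C u) \<zeta> = c *\<^sub>C \<pi> u \<zeta>"
  unfolding representation_tensor_def op_def[symmetric]
  by (rule tensor_lift.lift_scaleC[OF tensor_lift_op])

lemma operator_on_rep: "operator_on D (\<pi> u)"
proof (induction u)
  case (tensor a b)
  then show ?case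
    by (simp add: operator_on_def clinear_on_def rep_tensor op_add op_scaleC
        op_outside)
next
  case (add u v)
  then show ?case
    by (simp add: operator_on_def clinear_on_def rep_add scaleC_add_right)
qed

lemma rep_vector_add: "\<lbrakk>\<zeta> \<in> D; \<zeta>' \<in> D\<rbrakk> \<Longrightarrow> \<pi> u (\<zeta> + \<zeta>') = \<pi> u \<zeta> + \<pi> u \<zeta>'"
  using operator_on_rep[of u] by (simp add: operator_on_def clinear_on_def)

text \<open>Operators stand in all four places so that the involution and product identities are
  both instances; where one is missing, \<open>\<pi> (eA \<otimes> eB)\<close> acts as the
  identity.\<close>

lemma cinner_domain_eqI:
  assumes "\<zeta> \<in> D" and "\<zeta>' \<in> D"
    and "\<And>\<xi> \<eta> \<xi>' \<eta>'. \<lbrakk>\<xi> \<in> D1; \<eta> \<in> D2; \<xi>' \<in> D1; \<eta>' \<in> D2\<rbrakk>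
      \<Longrightarrow> cinner (\<pi> u (h \<xi> \<eta>)) (\<pi> v (h \<xi>' \<eta>')) = cinner (\<pi> u' (h \<xi> \<eta>)) (\<pi> v' (h \<xi>' \<eta>'))"
  shows "cinner (\<pi> u \<zeta>) (\<pi> v \<zeta>') = cinner (\<pi> u' \<zeta>) (\<pi> v' \<zeta>')"
  using assms(1)
proof (induction rule: domain_induct)
  case (tensor \<xi> \<eta>)
  show ?case
    using assms(2)
    by (induction rule: domain_induct)
      (simp_all add: assms(3) tensor rep_vector_add cinner_add_right)
qed (simp add: rep_vector_add cinner_add_left)

section \<open>Unit, involution and product under the tensor product of representations\<close>

lemma rep_unit:
  assumes "\<zeta> \<in> D"
  shows "\<pi> (eA \<otimes> eB) \<zeta> = \<zeta>"
  using assms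
  by (induction rule: domain_induct)
    (simp_all add: rep_tensor op_tensor op_add R1.unit_apply R2.unit_apply)

lemma cinner_rep_star:
  assumes "\<zeta> \<in> D" and "\<zeta>' \<in> D"
  shows "cinner (\<pi> u \<zeta>) \<zeta>' = cinner \<zeta> (\<pi> (tensor_map starA starB u) \<zeta>')"
proof (induction u)
  case (tensor a b)
  have "cinner (\<pi> (a \<otimes> b) \<zeta>) (\<pi> (eA \<otimes> eB) \<zeta>')
      = cinner (\<pi> (eA \<otimes> eB) \<zeta>) (\<pi> (tensor_map starA starB (a \<otimes> b)) \<zeta>')"
    by (rule cinner_domain_eqI[OF assms])
      (simp add: tensor_star_tensor rep_tensor op_tensor cinner_tensor R1.unit_apply R2.unit_apply
        R1.cinner_star R2.cinner_star)
  then show ?case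
    by (simp add: rep_unit assms)
next
  case (add u v)
  then show ?case
    by (simp add: rep_add tensor_star_add cinner_add_left cinner_add_right)
qed

text \<open>Additivity in \<open>v\<close>, in \<open>u\<close> and in both vectors leaves only
  simple tensors, where the identity is the product of those for \<open>\<pi>1\<close> and
  \<open>\<pi>2\<close>.\<close>

lemma cinner_rep_mult:
  assumes v: "v \<in> tensor_subspace A0 B0" and \<zeta>: "\<zeta> \<in> D" "\<zeta>' \<in> D"
  shows "cinner (\<pi> (tensor_map starA starB u) \<zeta>') (\<pi> v \<zeta>)
    = cinner \<zeta>' (\<pi> (tensor_mult A0 mA B0 mB u v) \<zeta>)"
  using v unfolding tensor_subspace_def
proof (induction rule: cspan_bilinear_induct)
  case (tensor x y)
  \<comment> \<open>The product is rewritten before the induction on \<open>u\<close> because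
    additivity in \<open>u\<close> is available for \<open>mult_simple\<close>.\<close>
  show ?case
    unfolding tensor_mult_tensor[OF tensor]
  proof (induction u)
    case (tensor a b)
    have "cinner (\<pi> (tensor_map starA starB (a \<otimes> b)) \<zeta>') (\<pi> (x \<otimes> y) \<zeta>)
        = cinner (\<pi> (eA \<otimes> eB) \<zeta>') (\<pi> (mult_simple (a \<otimes> b) x y) \<zeta>)"
      by (rule cinner_domain_eqI[OF \<zeta>(2,1)])
        (simp add: tensor_star_tensor mult_simple_tensor[OF \<open>x \<in> A0\<close> \<open>y \<in> B0\<close>] rep_tensor
          op_tensor cinner_tensor R1.unit_apply R2.unit_apply R1.cinner_mult[OF \<open>x \<in> A0\<close>]
          R2.cinner_mult[OF \<open>y \<in> B0\<close>])
    then show ?case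
      by (simp add: rep_unit \<zeta>)
  next
    case (add u v)
    then show ?case
      by (simp add: tensor_star_add mult_simple_add[OF tensor] rep_add cinner_add_left
          cinner_add_right)
  qed
next
  case (add v w)
  then show ?case
    by (simp add: tensor_mult_add rep_add cinner_add_right flip: tensor_subspace_def)
qed (simp_all add: A.subspace B.subspace tensor_scaleC_left)

sublocale tensor: star_representation "tensor_subspace A0 B0" "tensor_mult A0 mA B0 mB"
  "tensor_map starA starB" "eA \<otimes> eB" D \<pi>
  by (rule star_representationI)
    (auto simp: subspace_domain dense_domain operator_on_rep rep_add rep_scaleC rep_unit
      cinner_rep_star cinner_rep_mult)

end


section \<open>Weak continuity\<close>

text \<open>Weak continuity at zero bounds the coefficient by 1 on some ball, and homogeneity
  spreads this bound to the whole space.\<close>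

lemma weakly_continuous_imp_bounded:
  fixes A0 :: "'a::complex_normed_vector set"
  assumes rep: "star_representation A0 m star e D \<pi>"
    and cont: "continuous_map euclidean (weak_topology D) \<pi>" and \<xi>: "\<xi> \<in> D" "\<eta> \<in> D"
  obtains K where "\<And>a. cmod (cinner (\<pi> a \<xi>) \<eta>) \<le> norm a * K"
proof -
  interpret star_representation A0 m star e D \<pi> by fact
  let ?f = "\<lambda>a. cinner (\<pi> a \<xi>) \<eta>"
  have zero: "\<pi> 0 \<xi> = 0" for \<xi>
    using scaleC[of 0 0] by simp
  have "openin (weak_topology D) {S \<in> Ldag D. cmod (cinner (S \<xi> - \<pi> 0 \<xi>) \<eta>) < 1}"
    unfolding weak_topology_def using maps_to \<xi>
    by (intro topology_generated_by_Basis) (blast intro: zero_less_one)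
  from openin_continuous_map_preimage[OF cont this]
  have "open {a. cmod (?f a) < 1}"
    by (simp add: maps_to zero)
  moreover have "0 \<in> {a. cmod (?f a) < 1}"
    by (simp add: zero)
  ultimately obtain d where d: "d > 0" "\<And>a. norm a < d \<Longrightarrow> cmod (?f a) < 1"
    by (auto simp: open_dist)
  have "cmod (?f a) \<le> norm a * (2 / d)" for a
  proof (cases "a = 0")
    case False
    \<comment> \<open>This factor scales \<open>a\<close> to norm \<open>d / 2\<close>, safely
      inside the ball.\<close>
    define r where "r = d / (2 * norm a)"
    have r: "r > 0" using d False by (simp add: r_def)
    have "norm (of_real r *\<^sub>C a) = r * norm a"
      using r by (simp add: norm_scaleC)
    also have "\<dots> < d"
      using d(1) False by (simp add: r_def)
    finally have "norm (of_real r *\<^sub>C a) < d" .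
    from d(2)[OF this] have "r * cmod (?f a) < 1"
      using r by (simp add: scaleC cinner_scaleC_left norm_mult)
    then show ?thesis
      using d False by (simp add: r_def field_simps)
  qed (simp add: zero)
  then show ?thesis using that by blast
qed

text \<open>It is enough that preimages of the generating sets are open. The bound on a coefficient
  converts the slack left in the defining inequality of such a set into a radius for
  \<open>n\<close>.\<close>

lemma continuous_map_weak_topology:
  fixes n :: "'t::complex_vector \<Rightarrow> real"
  assumes metric: "Metric_space UNIV (\<lambda>u v. n (u - v))"
    and rep: "star_representation A0 m star e D \<pi>"
    and bound: "\<And>\<xi> \<eta>. \<lbrakk>\<xi> \<in> D; \<eta> \<in> D\<rbrakk> \<Longrightarrow> \<exists>K. \<forall>u. cmod (cinner (\<pi> u \<xi>) \<eta>) \<le> K * n u"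
  shows "continuous_map (norm_topology n) (weak_topology D) \<pi>"
proof -
  interpret star_representation A0 m star e D \<pi> by fact
  interpret Metric_space UNIV "\<lambda>u v. n (u - v)" by fact
  have diff: "\<pi> (u - v) \<xi> = \<pi> u \<xi> - \<pi> v \<xi>" for u v \<xi>
    using add[of "u - v" v] by (simp add: fun_eq_iff)
  have open_ball: "openin (norm_topology n) {u. cmod (cinner (\<pi> u \<xi> - T \<xi>) \<eta>) < r}"
    if \<xi>: "\<xi> \<in> D" "\<eta> \<in> D" for T \<xi> \<eta> r
    unfolding norm_topology_def openin_mtopology
  proof (intro conjI allI impI)
    fix u
    assume u: "u \<in> {u. cmod (cinner (\<pi> u \<xi> - T \<xi>) \<eta>) < r}"
    obtain K where K: "cmod (cinner (\<pi> u \<xi>) \<eta>) \<le> K * n u" for u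
      using bound[OF \<xi>] by blast
    have n: "n u \<ge> 0" for u
      using nonneg[of u 0] by simp
    \<comment> \<open>Replacing \<open>K\<close> by \<open>\<bar>K\<bar> + 1\<close> gives a
      positive constant, which can be the denominator of the radius \<open>s\<close>.\<close>
    have K': "cmod (cinner (\<pi> u \<xi>) \<eta>) \<le> (\<bar>K\<bar> + 1) * n u" for u
      using K[of u] n[of u] mult_right_mono[of K "\<bar>K\<bar> + 1" "n u"] by linarith
    define s where "s = (r - cmod (cinner (\<pi> u \<xi> - T \<xi>) \<eta>)) / (\<bar>K\<bar> + 1)"
    have "mball u s \<subseteq> {u. cmod (cinner (\<pi> u \<xi> - T \<xi>) \<eta>) < r}"
    proof
      fix v
      assume "v \<in> mball u s"
      then have v: "n (v - u) < s"
        using commute[of u v] by simp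
      have "cmod (cinner (\<pi> (v - u) \<xi>) \<eta>) < r - cmod (cinner (\<pi> u \<xi> - T \<xi>) \<eta>)"
        using K'[of "v - u"] v by (simp add: s_def field_simps)
      moreover have "cinner (\<pi> v \<xi> - T \<xi>) \<eta>
          = cinner (\<pi> (v - u) \<xi>) \<eta> + cinner (\<pi> u \<xi> - T \<xi>) \<eta>"
        by (simp add: diff cinner_diff_left)
      ultimately show "v \<in> {u. cmod (cinner (\<pi> u \<xi> - T \<xi>) \<eta>) < r}"
        using norm_triangle_ineq[of "cinner (\<pi> (v - u) \<xi>) \<eta>" "cinner (\<pi> u \<xi> - T \<xi>) \<eta>"] by simp
    qed
    moreover have "s > 0"
      using u by (simp add: s_def)
    ultimately show "\<exists>r'>0. mball u r' \<subseteq> {u. cmod (cinner (\<pi> u \<xi> - T \<xi>) \<eta>) < r}"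
      by blast
  qed simp
  have top: "topspace (norm_topology n) = UNIV"
    by (simp add: norm_topology_def)
  show ?thesis
    unfolding weak_topology_def
  proof (rule continuous_on_generated_topo)
    fix U
    assume "U \<in> {{S \<in> Ldag D. cmod (cinner (S \<xi> - T \<xi>) \<eta>) < r} | T \<xi> \<eta> r.
      T \<in> Ldag D \<and> \<xi> \<in> D \<and> \<eta> \<in> D \<and> r > 0}"
    then obtain T \<xi> \<eta> r where "U = {S \<in> Ldag D. cmod (cinner (S \<xi> - T \<xi>) \<eta>) < r}"
      and "\<xi> \<in> D" "\<eta> \<in> D"
      by blast
    then show "openin (norm_topology n) (\<pi> -` U \<inter> topspace (norm_topology n))"
      using open_ball[of \<xi> \<eta> T r] by (simp add: vimage_def top maps_to)
  next
    \<comment> \<open>The generating sets cover the image: each \<open>\<pi> u\<close> lies in the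
      one centred at itself with both vectors zero and radius 1.\<close>
    have "\<pi> u \<in> {S \<in> Ldag D. cmod (cinner (S 0 - \<pi> u 0) 0) < 1}" for u
      by (simp add: maps_to)
    then show "\<pi> ` topspace (norm_topology n) \<subseteq> \<Union> {{S \<in> Ldag D. cmod (cinner (S \<xi> - T \<xi>) \<eta>) < r}
        | T \<xi> \<eta> r. T \<in> Ldag D \<and> \<xi> \<in> D \<and> \<eta> \<in> D \<and> r > 0}"
      using maps_to zero_in_domain zero_less_one by blast
  qed
qed

lemma (in uniform_cross_norm) Metric_space_norm: "Metric_space UNIV (\<lambda>u v. n (u - v))"
proof
  show "n (u - v) = n (v - u)" for u v
    using scale[of "-1" "v - u"] by simp
  show "n (u - w) \<le> n (u - v) + n (v - w)" for u v w
    using triangle[of "u - v" "v - w"] by simp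
qed (simp_all add: nonneg eq_zero_iff)

theorem proposition6p5:
  fixes A0 :: "'a::cbanach set" and mA :: "'a \<Rightarrow> 'a \<Rightarrow> 'a" and starA :: "'a \<Rightarrow> 'a" and eA :: 'a
    and B0 :: "'b::cbanach set" and mB :: "'b \<Rightarrow> 'b \<Rightarrow> 'b" and starB :: "'b \<Rightarrow> 'b" and eB :: 'b
    and n :: "('a, 'b) tensor \<Rightarrow> real"
    and D1 :: "'h::chilbert_space set" and \<pi>1 :: "'a \<Rightarrow> 'h \<Rightarrow> 'h"
    and D2 :: "'k::chilbert_space set" and \<pi>2 :: "'b \<Rightarrow> 'k \<Rightarrow> 'k"
    and h :: "'h \<Rightarrow> 'k \<Rightarrow> 'l::chilbert_space"
  assumes "banach_quasi_star_algebra A0 mA starA eA"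
    and "banach_quasi_star_algebra B0 mB starB eB"
    and "uniform_cross_norm n"
    and "\<And>u. n (tensor_map starA starB u) = n u"
    and "star_representation A0 mA starA eA D1 \<pi>1"
    and "continuous_map euclidean (weak_topology D1) \<pi>1"
    and "star_representation B0 mB starB eB D2 \<pi>2"
    and "continuous_map euclidean (weak_topology D2) \<pi>2"
    and "hilbert_tensor_product h"
  shows "star_representation (tensor_subspace A0 B0) (tensor_mult A0 mA B0 mB)
           (tensor_map starA starB) (eA \<otimes> eB)
           (domain_tensor h D1 D2) (representation_tensor h D1 D2 \<pi>1 \<pi>2)
       \<and> continuous_map (norm_topology n) (weak_topology (domain_tensor h D1 D2))
           (representation_tensor h D1 D2 \<pi>1 \<pi>2)"
proof -
  interpret A: banach_quasi_star_algebra A0 mA starA eA by fact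
  interpret B: banach_quasi_star_algebra B0 mB starB eB by fact
  interpret N: uniform_cross_norm n by fact
  interpret P1: star_representation A0 mA starA eA D1 \<pi>1 by fact
  interpret P2: star_representation B0 mB starB eB D2 \<pi>2 by fact
  interpret H: hilbert_tensor_product h by fact
  \<comment> \<open>This interpretation already supplies the *-representation through the sublocale
    \<open>tensor\<close>; continuity remains.\<close>
  interpret star_representation_pair A0 mA starA eA B0 mB starB eB D1 \<pi>1 D2 \<pi>2 h ..
  have simple: "\<exists>K. \<forall>u. cmod (cinner (\<pi> u (h \<xi> \<eta>)) (h \<xi>' \<eta>')) \<le> K * n u"
    if D: "\<xi> \<in> D1" "\<eta> \<in> D2" "\<xi>' \<in> D1" "\<eta>' \<in> D2" for \<xi> \<eta> \<xi>' \<eta>'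
  proof -
    define T where "T a = cinner (\<pi>1 a \<xi>) \<xi>' *\<^sub>C eA" for a
    define S where "S b = cinner (\<pi>2 b \<eta>) \<eta>' *\<^sub>C eB" for b
    have T: "clinear T" and S: "clinear S"
      by (simp_all add: clinear_iff T_def S_def P1.add_apply P1.scaleC_apply P2.add_apply
          P2.scaleC_apply
          cinner_add_left cinner_scaleC_left scaleC_add_left scaleC_scaleC)
    obtain K1 where K1: "cmod (cinner (\<pi>1 a \<xi>) \<xi>') \<le> norm a * K1" for a
      using weakly_continuous_imp_bounded[OF assms(5,6)] D by blast
    obtain K2 where K2: "cmod (cinner (\<pi>2 b \<eta>) \<eta>') \<le> norm b * K2" for b
      using weakly_continuous_imp_bounded[OF assms(7,8)] D by blast
    have "bounded_clinear T" "bounded_clinear S"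
      using T S K1 K2
      by (auto simp: bounded_clinear_def T_def S_def norm_scaleC A.norm_unit B.norm_unit)
    then obtain K where K: "n (tensor_map T S u) \<le> K * n u" for u
      using N.bounded by blast
    have TS: "T a \<otimes> S b = (cinner (\<pi>1 a \<xi>) \<xi>' * cinner (\<pi>2 b \<eta>) \<eta>') *\<^sub>C (eA \<otimes> eB)" for a b
      by (simp add: T_def S_def tensor_scaleC_left tensor_scaleC_right scaleC_scaleC mult.commute)
    \<comment> \<open>The map \<open>T \<otimes> S\<close> is the coefficient times the fixed tensor
      \<open>eA \<otimes> eB\<close> of norm 1, so the \<open>n\<close>-bound for it is a bound for
      the coefficient.\<close>
    have "tensor_map T S u = cinner (\<pi> u (h \<xi> \<eta>)) (h \<xi>' \<eta>') *\<^sub>C (eA \<otimes> eB)" for u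
      by (induction u)
        (simp_all add: tensor_map_tensor[OF T S] tensor_map_add[OF T S] TS rep_tensor rep_add
          op_tensor D H.cinner_tensor cinner_add_left scaleC_add_left)
    then have "n (tensor_map T S u) = cmod (cinner (\<pi> u (h \<xi> \<eta>)) (h \<xi>' \<eta>'))" for u
      by (simp add: N.scale N.cross A.norm_unit B.norm_unit)
    then show ?thesis
      using K by metis
  qed
  \<comment> \<open>Bounds of this kind add up, which carries them from simple vectors to all of
    \<open>D\<close> in each argument of the inner product.\<close>
  have sum_bound: "\<exists>K. \<forall>u. cmod (f u + g u) \<le> K * n u"
    if "\<exists>K. \<forall>u. cmod (f u) \<le> K * n u" "\<exists>K. \<forall>u. cmod (g u) \<le> K * n u" for f g
  proof -
    obtain K L where "\<And>u. cmod (f u) \<le> K * n u" "\<And>u. cmod (g u) \<le> L * n u"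
      using \<open>\<exists>K. \<forall>u. cmod (f u) \<le> K * n u\<close> \<open>\<exists>K. \<forall>u. cmod (g u) \<le> K * n u\<close> by blast
    then have "cmod (f u + g u) \<le> (K + L) * n u" for u
      using norm_triangle_mono[of "f u" _ "g u"] by (simp add: distrib_right)
    then show ?thesis by blast
  qed
  have "\<exists>K. \<forall>u. cmod (cinner (\<pi> u \<zeta>) \<zeta>') \<le> K * n u" if \<zeta>: "\<zeta> \<in> D" "\<zeta>' \<in> D" for \<zeta> \<zeta>'
    using \<zeta>(1)
  proof (induction rule: domain_induct)
    case (tensor \<xi> \<eta>)
    show ?case
      using \<zeta>(2)
      by (induction rule: domain_induct) (simp_all add: simple tensor cinner_add_right sum_bound)
  qed (simp add: rep_vector_add cinner_add_left sum_bound)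
  then show ?thesis
    using continuous_map_weak_topology[OF N.Metric_space_norm tensor.star_representation_axioms]
      tensor.star_representation_axioms by blast
qed

end
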